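(* Let $M_n=m_n(X^n)$ be a maximally invariant statistic for the action of $G$ on $\mathcal{X}^n$. Let $\tilde{\mathbf{\Pi}}_0$ and $\tilde{\mathbf{\Pi}}_1$ be two probability distributions on $\Delta_0$ and $\Delta_1$, respectively. Let $\{\tilde{\mathbf{P}}_g\}_{g\in G}$ and $\{\tilde{\mathbf{Q}}_g\}_{g\in G}$ be the two models on $\mathcal{X}^n$ defined by $\tilde{\mathbf{P}}_g=\tilde{\mathbf{\Pi}}_0^\delta\mathbf{P}_{g,\delta}$ and $\tilde{\mathbf{Q}}_g=\tilde{\mathbf{\Pi}}_1^\delta\mathbf{Q}_{g,\delta}$. Suppose that $G$ is amenable and that: (1) as topological spaces, $G$ and $\mathcal{X}^n$ are Polish and locally compact; (2) the action of $G$ on $\mathcal{X}^n$ is free, continuous and proper; (3) $\{\tilde{\mathbf{P}}_g\}_{g\in G}$ and $\{\tilde{\mathbf{Q}}_g\}_{g\in G}$ are invariant and have densities $\tilde p_g,\tilde q_g$ with respect to a common measure $\mu$ on $\mathcal{X}^n$ that is relatively left invariant with some multiplier $\chi$, and all densities have a single common support; (4) there is $\varepsilon>0$ such that $$\mathbf{E}_{X^n\sim\tilde{\mathbf{Q}}_1}\left[\left|\ln\frac{\tilde q_1(X^n)}{\tilde p_1(X^n)}\right|^{1+\varepsilon}\right]<\infty\quad\text{and}\quad\mathbf{E}_{X^n\sim\tilde{\mathbf{Q}}_1}\left[\left|\ln\frac{\tilde q^{M_n}(M_n)}{\tilde p^{M_n}(M_n)}\right|^{1+\varepsilon}\right]<\infty,$$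 where the subindex $1$ refers to the unit element of $G$ and $\tilde p^{M_n},\tilde q^{M_n}$ are the densities of $M_n$ under $\tilde{\mathbf{P}}_g$ and $\tilde{\mathbf{Q}}_g$ (which do not depend on $g$). Then the e-statistic $$\tilde T_n=\frac{\int q_\delta^{M_n}(m_n(X^n))\,\mathrm{d}\tilde{\mathbf{\Pi}}_1(\delta)}{\int p_\delta^{M_n}(m_n(X^n))\,\mathrm{d}\tilde{\mathbf{\Pi}}_0(\delta)}$$ is both GROW and relatively GROW for testing $\{\tilde{\mathbf{P}}_g\}_{g\in G}$ (null) against $\{\tilde{\mathbf{Q}}_g\}_{g\in G}$ (alternative).
   Context: $G$ is a topological group acting on the observation space $\mathcal{X}$, on $\mathcal{X}^n$ componentwise, and freely on a parameter space $\Theta$; $G$ and $\mathcal{X}^n$ carry their Borel $\sigma$-algebras. $X^n$ is the data, with values in $\mathcal{X}^n$. $\{\mathbf{P}_\theta\}_{\theta\in\Theta}$ is an invariant model: $\mathbf{P}_\theta\{X^n\in B\}=\mathbf{P}_{g\theta}\{X^n\in gB\}$. The parameter of interest $\delta=\delta(\theta)$ is maximally invariant: $\delta(\theta)=\delta(\theta')$ iff $\theta=g\theta'$ for some $g\in G$. For each value $\delta$ one fixes an element $\theta_\delta$ with $\delta(\theta_\delta)=\delta$; for $\delta\in\Delta_0$ set $\mathbf{P}_{g,\delta}=\mathbf{P}_{g\theta_\delta}$, and for $\delta\in\Delta_1$ set $\mathbf{Q}_{g,\delta}=\mathbf{P}_{g\theta_\delta}$, where $\Delta_0,\Delta_1$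 are two sets of values of $\delta$. A family $\{\mathbf{P}_g\}_{g\in G}$ is invariant if $\mathbf{P}_{hg}\{X^n\in hB\}=\mathbf{P}_g\{X^n\in B\}$ for all $g,h\in G$ and measurable $B\subseteq\mathcal X^n$. The distributions are assumed to depend measurably on $(g,\delta)$ so that mixtures are defined; $\mathbf{\Pi}^\delta\mathbf{P}_{g,\delta}$ denotes $B\mapsto\int\mathbf{P}_{g,\delta}\{B\}\,\mathrm{d}\mathbf{\Pi}(\delta)$. Statistics are measurable functions of the data with values in a standard Borel space. $M_n=m_n(X^n)$ is maximally invariant if $m_n(x)=m_n(x')$ iff $x=gx'$ for some $g\in G$. Its distribution under $\mathbf{P}_{g,\delta}$ (resp. $\mathbf{Q}_{g,\delta}$) does not depend on $g$; its density, with respect to a common dominating measure, is $p_\delta^{M_n}$ (resp. $q_\delta^{M_n}$). Relatively left invariant with multiplier $\chi$: $\mu\{gB\}=\chi(g)\mu\{B\}$ for measurable $B\subseteq\mathcal{X}^n$, $g\in G$. Single common support: the densities are positive on one and the same set. Free action: $gx=x$ for some $x$ implies $g$ is the identity. Proper action: $(g,x)\mapsto(gx,x)$ has compact preimages of compact sets. Amenability: there is a sequence $\mathbf{\Pi}_1,\mathbf{\Pi}_2,\dots$ of probability distributions on $G$ such that $\lim_{k\to\infty}|\mathbf{\Pi}_k\{B\}-\mathbf{\Pi}_k\{Bg\}|=0$ for every measurable $B\subseteq G$ and $g\in G$. E-statistic (for the null $\{\tilde{\mathbf{P}}_g\}$): a statistic $T_n=t_n(X^n)\ge0$ with $\sup_{g\in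 G}\mathbf{E}_{X^n\sim\tilde{\mathbf{P}}_g}[T_n]\le1$. GROW: maximizes $\inf_{g\in G}\mathbf{E}_{X^n\sim\tilde{\mathbf{Q}}_g}[\ln T_n]$ over all e-statistics. Relatively GROW: maximizes $\inf_{g\in G}\{\mathbf{E}_{X^n\sim\tilde{\mathbf{Q}}_g}[\ln T_n]-\sup_{T_n'\ \text{e-statistic}}\mathbf{E}_{X^n\sim\tilde{\mathbf{Q}}_g}[\ln T_n']\}$ over all e-statistics. *)

theory Defs
  imports "HOL-Probability.Probability"
begin

text \<open>Topological groups are written additively, as in \<^class>\<open>topological_group_add\<close>, which
  is not assumed commutative: \<open>g + h\<close> is the product and \<open>0\<close> the unit. The sample space
  \<open>\<X>\<^sup>n\<close> is \<open>'n \<Rightarrow> 'x\<close> for a finite index type \<open>'n\<close> of cardinality \<open>n\<close>, with the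
  product topology; if \<open>'x\<close> is Polish then so is \<open>'n \<Rightarrow> 'x\<close>.\<close>

definition is_action :: "('g::group_add \<Rightarrow> 'y \<Rightarrow> 'y) \<Rightarrow> bool" where
  "is_action act \<longleftrightarrow> (\<forall>x. act 0 x = x) \<and> (\<forall>g h x. act (g + h) x = act g (act h x))"

definition componentwise :: "('g \<Rightarrow> 'x \<Rightarrow> 'x) \<Rightarrow> 'g \<Rightarrow> ('n \<Rightarrow> 'x) \<Rightarrow> ('n \<Rightarrow> 'x)" where
  "componentwise act g x = (\<lambda>i. act g (x i))"

definition free_action :: "('g::zero \<Rightarrow> 'y \<Rightarrow> 'y) \<Rightarrow> bool" where
  "free_action act \<longleftrightarrow> (\<forall>g x. act g x = x \<longrightarrow> g = 0)"

definition continuous_action ::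
    "('g::topological_space \<Rightarrow> 'y::topological_space \<Rightarrow> 'y) \<Rightarrow> bool" where
  "continuous_action act \<longleftrightarrow> continuous_on UNIV (\<lambda>(g, x). act g x)"

definition proper_action ::
    "('g::topological_space \<Rightarrow> 'y::topological_space \<Rightarrow> 'y) \<Rightarrow> bool" where
  "proper_action act \<longleftrightarrow> (\<forall>K. compact K \<longrightarrow> compact ((\<lambda>(g, x). (act g x, x)) -` K))"

definition maximally_invariant :: "('g \<Rightarrow> 'y \<Rightarrow> 'y) \<Rightarrow> ('y \<Rightarrow> 'm) \<Rightarrow> bool" where
  "maximally_invariant act m \<longleftrightarrow> (\<forall>x x'. m x = m x' \<longleftrightarrow> (\<exists>g. x = act g x'))"

text \<open>The index set of the family is acted on by \<open>pact\<close>. With \<open>pact = (+)\<close> this is the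
  invariance of a family indexed by the group itself.\<close>

definition invariant_model ::
    "('g \<Rightarrow> 'y::topological_space \<Rightarrow> 'y) \<Rightarrow> ('g \<Rightarrow> 't \<Rightarrow> 't) \<Rightarrow> ('t \<Rightarrow> 'y measure) \<Rightarrow> bool" where
  "invariant_model act pact P \<longleftrightarrow>
     (\<forall>g \<theta>. \<forall>B\<in>sets borel. measure (P (pact g \<theta>)) (act g ` B) = measure (P \<theta>) B)"

definition relatively_left_invariant ::
    "('g \<Rightarrow> 'y::topological_space \<Rightarrow> 'y) \<Rightarrow> 'y measure \<Rightarrow> ('g \<Rightarrow> real) \<Rightarrow> bool" where
  "relatively_left_invariant act \<mu> \<kappa> \<longleftrightarrow>
     (\<forall>g. \<forall>B\<in>sets borel. emeasure \<mu> (act g ` B) = ennreal (\<kappa> g) * emeasure \<mu> B)"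

definition amenable :: "'g::topological_group_add itself \<Rightarrow> bool" where
  "amenable _ \<longleftrightarrow> (\<exists>Pr :: nat \<Rightarrow> 'g measure.
     (\<forall>k. prob_space (Pr k) \<and> sets (Pr k) = sets borel) \<and>
     (\<forall>B\<in>sets borel. \<forall>g.
        (\<lambda>k. \<bar>measure (Pr k) B - measure (Pr k) ((\<lambda>h. h + g) ` B)\<bar>) \<longlonglongrightarrow> 0))"

text \<open>The real \<^const>\<open>ln\<close> satisfies \<open>ln 0 = 0\<close>, which would reward an e-statistic for
  vanishing; here \<open>ln 0 = -\<infinity>\<close>.\<close>

definition eln :: "ennreal \<Rightarrow> ereal" where
  "eln t = (if t = 0 then - \<infinity> else if t = \<top> then \<infinity> else ereal (ln (enn2real t)))"

text \<open>\<open>\<infinity> - \<infinity>\<close> evaluates to \<open>\<infinity>\<close> in \<^typ>\<open>ereal\<close>, so this is the expectation only if one of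
  the two parts is finite. For \<open>\<integral>\<^sup>+x. T x \<partial>P \<le> 1\<close> the positive part of \<open>ln T\<close> has finite
  expectation under every \<open>Q\<close> of finite Kullback-Leibler divergence from \<open>P\<close>.\<close>

definition expect_ln :: "'y measure \<Rightarrow> ('y \<Rightarrow> ennreal) \<Rightarrow> ereal" where
  "expect_ln M T = enn2ereal (\<integral>\<^sup>+x. e2ennreal (eln (T x)) \<partial>M)
                 - enn2ereal (\<integral>\<^sup>+x. e2ennreal (- eln (T x)) \<partial>M)"

definition e_statistic :: "('g \<Rightarrow> 'y::topological_space measure) \<Rightarrow> ('y \<Rightarrow> ennreal) \<Rightarrow> bool" where
  "e_statistic P T \<longleftrightarrow> T \<in> borel_measurable borel \<and> (SUP g. \<integral>\<^sup>+x. T x \<partial>P g) \<le> 1"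

definition GROW :: "('g \<Rightarrow> 'y::topological_space measure) \<Rightarrow> ('g \<Rightarrow> 'y measure) \<Rightarrow>
    ('y \<Rightarrow> ennreal) \<Rightarrow> bool" where
  "GROW P Q T \<longleftrightarrow> e_statistic P T \<and>
     (\<forall>S. e_statistic P S \<longrightarrow> (INF g. expect_ln (Q g) S) \<le> (INF g. expect_ln (Q g) T))"

definition relative_growth :: "('g \<Rightarrow> 'y::topological_space measure) \<Rightarrow> ('g \<Rightarrow> 'y measure) \<Rightarrow>
    ('y \<Rightarrow> ennreal) \<Rightarrow> ereal" where
  "relative_growth P Q T =
     (INF g. expect_ln (Q g) T - (SUP S\<in>{S. e_statistic P S}. expect_ln (Q g) S))"

definition relatively_GROW :: "('g \<Rightarrow> 'y::topological_space measure) \<Rightarrow> ('g \<Rightarrow> 'y measure) \<Rightarrow>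
    ('y \<Rightarrow> ennreal) \<Rightarrow> bool" where
  "relatively_GROW P Q T \<longleftrightarrow> e_statistic P T \<and>
     (\<forall>S. e_statistic P S \<longrightarrow> relative_growth P Q S \<le> relative_growth P Q T)"

end

theory Submission
  imports Defs
begin

text \<open>Let \<open>T\<close> be the likelihood ratio of the maximal invariant. It is invariant, its law does not
  depend on \<open>g\<close>, and its growth is the constant \<open>K = KL(Q\<^sup>M, P\<^sup>M)\<close>. The claim is that no
  e-statistic \<open>S\<close> grows at a rate above \<open>K\<close> under all alternatives at once.

  By invariance of the models, the growth of \<open>S\<close> under \<open>Q\<^sub>g\<close> is that of the translate
  \<open>S(g x)\<close> under \<open>Q\<^sub>1\<close>, where \<open>1\<close> is the unit of the group, and every translate has expectation at most \<open>1\<close> under \<open>P\<^sub>1\<close>. Suppose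
  that all translates grow at a rate of at least \<open>c\<close>. Because the divergence of \<open>Q\<^sub>1\<close> from
  \<open>P\<^sub>1\<close> is finite, \<open>S\<close> can be truncated to a bounded function that is bounded away from \<open>0\<close>,
  with a small loss of growth that is uniform over the group (\<open>uniform_truncation\<close>).
  The averages \<open>\<integral>S(g x) d\<Pi>\<^sub>k(g)\<close> over the measures \<open>\<Pi>\<^sub>k\<close> that witness amenability retain the
  null expectation and, by Jensen's inequality, the growth; and along each orbit their
  oscillation tends to \<open>0\<close>. The functions with these bounds, integral constraints and
  oscillations form decreasing convex sets, and almost minimizers of the \<open>L\<^sup>2\<close> norm over these
  sets converge, along a subsequence, almost everywhere to an exactly invariant function \<open>V\<close>
  (\<open>averaged_orbit_limit\<close>).

  It remains to see that an invariant \<open>V\<close> with expectation at most \<open>1\<close> under \<open>P\<^sub>1\<close> grows at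
  most at rate \<open>K\<close>. By inner regularity, an invariant Borel set is the preimage of a Borel set
  under the maximal invariant up to a null set, so that on invariant functions \<open>Q\<^sub>1\<close> has
  density \<open>T\<close> with respect to \<open>P\<^sub>1\<close> (\<open>nn_integral_saturated_eq\<close>). Gibbs' inequality then gives
  the bound (\<open>growth_le_maximal_invariant\<close>).

  Relative optimality follows because the supremal growth over all e-statistics is the same
  finite number under every \<open>Q\<^sub>g\<close> (\<open>maximal_invariant_GROW\<close>).\<close>

section \<open>Invariant functions and the law of a maximal invariant\<close>

text \<open>A saturated set \<open>A\<close> is the preimage of \<open>m ` A\<close>, but this image need not be Borel. Compact
  subsets of the graph of \<open>m\<close> over \<open>A\<close> have compact projections to the second coordinate, and
  inner regularity of the law of \<open>(x, m x)\<close> lets countably many of them exhaust \<open>A\<close> up to a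
  null set.\<close>

lemma saturated_set_ae_preimage:
  fixes m :: "'y::polish_space \<Rightarrow> 'm::polish_space"
  assumes m [measurable]: "m \<in> borel_measurable borel" and A [measurable]: "A \<in> sets borel"
    and M [measurable_cong]: "sets M = sets borel" and fin: "finite_measure M"
    and sat: "\<And>x y. m x = m y \<Longrightarrow> x \<in> A \<Longrightarrow> y \<in> A"
  shows "\<exists>B\<in>sets borel. m -` B \<subseteq> A \<and> emeasure M (m -` B) = emeasure M A"
proof -
  interpret finite_measure M by fact
  have space_M: "space M = UNIV" using sets_eq_imp_space_eq[OF M] by simp
  define D where "D = distr M borel (\<lambda>x. (x, m x))"
  \<comment> \<open>the graph of \<open>m\<close> over \<open>A\<close>, with equality written as vanishing distance to make it visibly Borel\<close>
  define \<Gamma> where "\<Gamma> = {p. fst p \<in> A \<and> dist (snd p) (m (fst p)) = 0}"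
  have \<Gamma> [measurable]: "\<Gamma> \<in> sets borel"
  proof -
    have [measurable]: "fst \<in> borel_measurable (borel :: ('y \<times> 'm) measure)"
        "snd \<in> borel_measurable (borel :: ('y \<times> 'm) measure)"
      by (auto intro!: borel_measurable_continuous_onI continuous_intros)
    have "Measurable.pred borel (\<lambda>p::'y \<times> 'm. fst p \<in> A \<and> dist (snd p) (m (fst p)) = 0)"
      by measurable
    then show ?thesis unfolding \<Gamma>_def by (simp add: pred_def)
  qed
  have graph [measurable]: "(\<lambda>x. (x, m x)) \<in> M \<rightarrow>\<^sub>M borel"
    unfolding borel_prod[symmetric] by measurable
  have D_eq: "emeasure D C = emeasure M ((\<lambda>x. (x, m x)) -` C)" if "C \<in> sets borel" for C
    unfolding D_def using that by (subst emeasure_distr) (auto simp: space_M)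
  have "emeasure D \<Gamma> = (SUP K \<in> {K. K \<subseteq> \<Gamma> \<and> compact K}. emeasure D K)"
  proof (rule inner_regular)
    interpret D: finite_measure D unfolding D_def by (rule finite_measure_distr) simp
    show "emeasure D (space D) \<noteq> \<infinity>" by simp
  qed (simp_all add: D_def)
  moreover obtain F :: "nat \<Rightarrow> ennreal" where
      F: "range F \<subseteq> emeasure D ` {K. K \<subseteq> \<Gamma> \<and> compact K}"
         "(SUP K \<in> {K. K \<subseteq> \<Gamma> \<and> compact K}. emeasure D K) = (SUP i. F i)"
    using ennreal_SUP_countable_SUP[of "{K. K \<subseteq> \<Gamma> \<and> compact K}" "emeasure D"]
    by (metis (mono_tags, lifting) compact_empty empty_iff empty_subsetI mem_Collect_eq)
  moreover have "\<forall>i. \<exists>K. F i = emeasure D K \<and> K \<subseteq> \<Gamma> \<and> compact K"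
    using F(1) by blast
  then obtain K where K: "\<And>i. F i = emeasure D (K i)" "\<And>i. K i \<subseteq> \<Gamma>" "\<And>i. compact (K i)"
    by metis
  ultimately have D_sup: "emeasure D \<Gamma> = (SUP i. emeasure D (K i))" by simp
  define B where "B = (\<Union>i. snd ` K i)"
  have "snd ` K i \<in> sets borel" for i
    by (intro borel_closed compact_imp_closed compact_continuous_image K continuous_intros)
  then have B: "B \<in> sets borel" unfolding B_def by blast
  have sub: "m -` B \<subseteq> A"
  proof
    fix x assume "x \<in> m -` B"
    then obtain i p where "p \<in> K i" "m x = snd p" by (auto simp: B_def)
    with K(2)[of i] have "fst p \<in> A" "m (fst p) = m x" by (auto simp: \<Gamma>_def)
    then show "x \<in> A" using sat by blast
  qed
  have mB: "m -` B \<in> sets M"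
    using measurable_sets[OF m B] M by simp
  have "emeasure D (K i) \<le> emeasure M (m -` B)" for i
  proof -
    have "emeasure D (K i) = emeasure M ((\<lambda>x. (x, m x)) -` K i)"
      by (intro D_eq borel_closed compact_imp_closed K)
    also have "\<dots> \<le> emeasure M (m -` B)"
      by (rule emeasure_mono) (use mB in \<open>force simp: B_def\<close>)+
    finally show ?thesis .
  qed
  then have "emeasure D \<Gamma> \<le> emeasure M (m -` B)"
    unfolding D_sup by (rule SUP_least)
  moreover have "emeasure D \<Gamma> = emeasure M A"
    using D_eq[OF \<Gamma>] by (simp add: \<Gamma>_def vimage_def)
  moreover have "emeasure M (m -` B) \<le> emeasure M A"
    by (rule emeasure_mono[OF sub]) (simp add: M)
  ultimately have "emeasure M (m -` B) = emeasure M A" by (auto intro: antisym)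
  then show ?thesis using B sub by (intro bexI[of _ B] conjI)
qed

text \<open>The law of \<open>m\<close> determines a measure on the saturated Borel sets: if \<open>m -` B\<close> exhausts the
  \<open>M\<close>-mass of \<open>A\<close> from inside, then \<open>M A = M (m -` B) = N (m -` B) \<le> N A\<close>, and the
  argument is symmetric in \<open>M\<close> and \<open>N\<close>. This replaces a measurable factorization of \<open>u\<close>
  through \<open>m\<close>.\<close>

lemma nn_integral_saturated_eq:
  fixes m :: "'y::polish_space \<Rightarrow> 'm::polish_space"
  assumes m: "m \<in> borel_measurable borel"
    and M: "sets M = sets borel" "finite_measure M"
    and N: "sets N = sets borel" "finite_measure N"
    and law: "distr M borel m = distr N borel m"
    and u: "u \<in> borel_measurable borel" and sat: "\<And>x y. m x = m y \<Longrightarrow> u x = u y"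
  shows "(\<integral>\<^sup>+x. u x \<partial>M) = (\<integral>\<^sup>+x. u x \<partial>N)"
proof -
  define I where "I = {A \<in> sets borel. \<forall>x y. m x = m y \<longrightarrow> x \<in> A \<longrightarrow> y \<in> A}"
  have I_borel: "A \<in> sets borel" if "A \<in> I" for A
    using that unfolding I_def by (elim CollectE conjE)
  have I_sat: "y \<in> A" if "A \<in> I" "m x = m y" "x \<in> A" for A x y
    using that(1) that(2,3) unfolding I_def mem_Collect_eq by metis
  have I_I: "A \<in> I" if "A \<in> sets borel" "\<And>x y. m x = m y \<Longrightarrow> x \<in> A \<Longrightarrow> y \<in> A" for A
    unfolding I_def by (intro CollectI conjI allI impI) (fact that)+
  have I: "sigma_algebra UNIV I"
    unfolding sigma_algebra_iff2
  proof (intro conjI ballI allI impI)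
    show "I \<subseteq> Pow UNIV" by simp
    show "{} \<in> I" by (rule I_I) simp_all
    show "UNIV - A \<in> I" if "A \<in> I" for A
      using I_borel[OF that] sets.compl_sets[of A borel] I_sat[OF that]
      by (intro I_I) (simp, metis DiffD2 DiffI UNIV_I)
    show "(\<Union>i. A i) \<in> I" if "range A \<subseteq> I" for A :: "nat \<Rightarrow> 'y set"
    proof (rule I_I)
      show "(\<Union>i. A i) \<in> sets borel" using that I_borel by (intro sets.countable_UN) blast
      show "y \<in> (\<Union>i. A i)" if "m x = m y" "x \<in> (\<Union>i. A i)" for x y
        using that \<open>range A \<subseteq> I\<close> I_sat by (metis UN_iff range_subsetD)
    qed
  qed
  define F where "F = sigma UNIV I"
  have sets_F: "sets F = I" and space_F: "space F = UNIV"
    unfolding F_def using sigma_algebra.sets_measure_of_eq[OF I] by auto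
  have sub: "subalgebra M F" "subalgebra N F"
    unfolding subalgebra_def sets_F space_F
    using sets_eq_imp_space_eq[OF M(1)] sets_eq_imp_space_eq[OF N(1)]
    by (auto simp: M N I_borel)
  have le: "emeasure M A \<le> emeasure N A" if "A \<in> I" and MN:
    "sets M = sets borel" "finite_measure M" "sets N = sets borel"
    "distr M borel m = distr N borel m" for A and M N :: "'y measure"
  proof -
    from I_borel[OF \<open>A \<in> I\<close>] have A: "A \<in> sets borel" .
    obtain B where B: "B \<in> sets borel" "m -` B \<subseteq> A" "emeasure M (m -` B) = emeasure M A"
      using saturated_set_ae_preimage[OF m A MN(1,2)] I_sat[OF \<open>A \<in> I\<close>] by metis
    have sp: "space M = UNIV" "space N = UNIV"
      using sets_eq_imp_space_eq[OF MN(1)] sets_eq_imp_space_eq[OF MN(3)] by auto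
    have mm: "m \<in> borel_measurable M" "m \<in> borel_measurable N"
      using m MN(1,3) by (simp_all cong: measurable_cong_sets)
    have "emeasure M (m -` B) = emeasure N (m -` B)"
      using arg_cong[OF MN(4), of "\<lambda>L. emeasure L B"] B(1) mm
      by (simp add: emeasure_distr sp)
    also have "\<dots> \<le> emeasure N A" using B(2) A MN(3) by (intro emeasure_mono) auto
    finally show ?thesis using B(3) by simp
  qed
  have "restr_to_subalg M F = restr_to_subalg N F"
  proof (rule measure_eqI)
    fix A assume "A \<in> sets (restr_to_subalg M F)"
    then have "A \<in> I" using sub sets_F by (simp add: sets_restr_to_subalg)
    then show "emeasure (restr_to_subalg M F) A = emeasure (restr_to_subalg N F) A"
      using sub sets_F le[of A M N] le[of A N M] M N law
      by (simp add: emeasure_restr_to_subalg antisym)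
  qed (use sub in \<open>simp add: sets_restr_to_subalg\<close>)
  moreover have "u \<in> borel_measurable F"
  proof (rule measurableI)
    fix C :: "ennreal set" assume "C \<in> sets borel"
    then have "u -` C \<in> sets borel" using measurable_sets[OF u] by simp
    moreover have "m x = m y \<Longrightarrow> x \<in> u -` C \<Longrightarrow> y \<in> u -` C" for x y
      using sat[of x y] by simp
    ultimately show "u -` C \<inter> space F \<in> sets F"
      unfolding sets_F space_F Int_UNIV_right by (rule I_I)
  qed simp
  ultimately show ?thesis
    using nn_integral_subalgebra2[OF sub(1), of u] nn_integral_subalgebra2[OF sub(2), of u] by simp
qed

section \<open>Averages over an amenable group\<close>

text \<open>Asymptotic invariance on sets passes to bounded measurable functions because these are
  uniform limits of functions with finitely many values.\<close>

lemma amenable_integral_shift: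
  fixes \<phi> :: "'g::{topological_group_add, second_countable_topology} \<Rightarrow> real" and M :: "nat \<Rightarrow> 'g measure"
  assumes M: "\<And>k. prob_space (M k)" "\<And>k. sets (M k) = sets borel"
    and lim: "\<And>B g. B \<in> sets borel \<Longrightarrow>
      (\<lambda>k. \<bar>measure (M k) B - measure (M k) ((\<lambda>h. h + g) ` B)\<bar>) \<longlonglongrightarrow> 0"
    and \<phi> [measurable]: "\<phi> \<in> borel_measurable borel" and bound: "\<And>x. \<bar>\<phi> x\<bar> \<le> C"
  shows "(\<lambda>k. (\<integral>x. \<phi> (x + h) \<partial>M k) - (\<integral>x. \<phi> x \<partial>M k)) \<longlonglongrightarrow> 0"
proof (rule LIMSEQ_I)
  fix r :: real assume "0 < r"
  define e where "e = r / 3"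
  have e: "0 < e" using \<open>0 < r\<close> by (simp add: e_def)
  define n where "n = \<lceil>C / e\<rceil> + 1"
  define B where "B j = {x. \<lfloor>\<phi> x / e\<rfloor> = j}" for j
  define B' where "B' j = {x. x + h \<in> B j}" for j
  \<comment> \<open>\<open>\<phi>\<close> rounded down to multiples of \<open>e\<close>; boundedness leaves finitely many values\<close>
  define \<psi> where "\<psi> x = e * \<lfloor>\<phi> x / e\<rfloor>" for x
  have shift [measurable]: "(\<lambda>x::'g. x + h) \<in> borel_measurable borel"
    by (intro borel_measurable_continuous_onI continuous_intros)
  have \<psi> [measurable]: "\<psi> \<in> borel_measurable borel"
    unfolding \<psi>_def by measurable
  have B [measurable]: "B j \<in> sets borel" for j
  proof -
    have "Measurable.pred borel (\<lambda>x. \<lfloor>\<phi> x / e\<rfloor> = j)" by measurable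
    then show ?thesis by (simp add: B_def pred_def)
  qed
  have B' [measurable]: "B' j \<in> sets borel" for j
    using measurable_sets[OF shift B[of j]] by (simp add: B'_def vimage_def)
  have image: "(\<lambda>x. x + h) ` B' j = B j" for j
  proof
    show "B j \<subseteq> (\<lambda>x. x + h) ` B' j"
    proof
      fix x assume "x \<in> B j"
      then have "x - h \<in> B' j" by (simp add: B'_def)
      then show "x \<in> (\<lambda>x. x + h) ` B' j" by (rule rev_image_eqI) simp
    qed
  qed (auto simp: B'_def)
  have near: "\<bar>\<phi> x - \<psi> x\<bar> \<le> e" for x
  proof -
    have "\<bar>\<phi> x / e - \<lfloor>\<phi> x / e\<rfloor>\<bar> \<le> 1" by linarith
    then have "\<bar>\<phi> x / e - \<lfloor>\<phi> x / e\<rfloor>\<bar> * e \<le> e" using e by simp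
    moreover have "\<phi> x - \<psi> x = (\<phi> x / e - \<lfloor>\<phi> x / e\<rfloor>) * e"
      using e by (simp add: \<psi>_def field_simps)
    ultimately show ?thesis using e by (simp add: abs_mult)
  qed
  have range: "\<lfloor>\<phi> x / e\<rfloor> \<in> {-n..n}" for x
  proof -
    have "\<bar>\<phi> x / e\<bar> \<le> C / e" using bound[of x] e by (simp add: divide_right_mono)
    then show ?thesis unfolding n_def atLeastAtMost_iff by linarith
  qed
  have \<psi>_sum: "\<psi> x = (\<Sum>j\<in>{-n..n}. e * j * indicator (B j) x)" for x
  proof -
    have "(\<Sum>j\<in>{-n..n}. e * j * indicator (B j) x) = (\<Sum>j\<in>{-n..n}. if j = \<lfloor>\<phi> x / e\<rfloor> then e * j else 0)"
      by (intro sum.cong) (auto simp: B_def)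
    also have "\<dots> = \<psi> x" using range[of x] by (simp add: \<psi>_def)
    finally show ?thesis ..
  qed
  have int_\<psi>: "(\<integral>x. \<psi> x \<partial>M k) = (\<Sum>j\<in>{-n..n}. e * j * measure (M k) (B j))"
    and int_\<psi>': "(\<integral>x. \<psi> (x + h) \<partial>M k) = (\<Sum>j\<in>{-n..n}. e * j * measure (M k) (B' j))" for k
  proof -
    interpret prob_space "M k" by fact
    note M(2)[of k, measurable_cong]
    show "(\<integral>x. \<psi> x \<partial>M k) = (\<Sum>j\<in>{-n..n}. e * j * measure (M k) (B j))"
      unfolding \<psi>_sum by (subst Bochner_Integration.integral_sum)
        (auto intro!: integrable_mult_right integrable_real_indicator simp: M(2) less_top[symmetric])
    have *: "\<psi> (x + h) = (\<Sum>j\<in>{-n..n}. e * j * indicator (B' j) x)" for x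
      unfolding \<psi>_sum by (intro sum.cong) (auto simp: B'_def indicator_def)
    show "(\<integral>x. \<psi> (x + h) \<partial>M k) = (\<Sum>j\<in>{-n..n}. e * j * measure (M k) (B' j))"
      unfolding * by (subst Bochner_Integration.integral_sum)
        (auto intro!: integrable_mult_right integrable_real_indicator simp: M(2) less_top[symmetric])
  qed
  have "(\<lambda>k. \<Sum>j\<in>{-n..n}. e * j * (measure (M k) (B' j) - measure (M k) (B j))) \<longlonglongrightarrow> (\<Sum>j\<in>{-n..n}. e * j * 0)"
    using lim[OF B', of _ h] unfolding image tendsto_rabs_zero_iff
    by (intro tendsto_sum tendsto_mult tendsto_const)
  then have "(\<lambda>k. (\<integral>x. \<psi> (x + h) \<partial>M k) - (\<integral>x. \<psi> x \<partial>M k)) \<longlonglongrightarrow> 0"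
    unfolding int_\<psi> int_\<psi>' by (simp add: sum_subtractf right_diff_distrib)
  then obtain N where N: "\<bar>(\<integral>x. \<psi> (x + h) \<partial>M k) - (\<integral>x. \<psi> x \<partial>M k)\<bar> < e" if "k \<ge> N" for k
    using LIMSEQ_D[OF _ e] by force
  have "\<bar>(\<integral>x. \<phi> (x + h) \<partial>M k) - (\<integral>x. \<phi> x \<partial>M k)\<bar> < r" if "k \<ge> N" for k
  proof -
    interpret prob_space "M k" by fact
    note M(2)[of k, measurable_cong]
    have \<psi>_bound: "\<bar>\<psi> x\<bar> \<le> C + e" for x using near[of x] bound[of x] by linarith
    have int: "integrable (M k) \<phi>" "integrable (M k) (\<lambda>x. \<phi> (x + h))"
        "integrable (M k) \<psi>" "integrable (M k) (\<lambda>x. \<psi> (x + h))"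
      using bound \<psi>_bound 
      by (intro integrable_const_bound[where B = C] integrable_const_bound[where B = "C + e"] AE_I2;
          simp)+
    have le: "\<bar>(\<integral>x. f x \<partial>M k) - (\<integral>x. g x \<partial>M k)\<bar> \<le> e"
      if "integrable (M k) f" "integrable (M k) g" "\<And>x. \<bar>f x - g x\<bar> \<le> e" for f g :: "'g \<Rightarrow> real"
    proof -
      have "\<bar>(\<integral>x. f x \<partial>M k) - (\<integral>x. g x \<partial>M k)\<bar> = \<bar>\<integral>x. f x - g x \<partial>M k\<bar>"
        using that by simp
      also have "\<dots> \<le> (\<integral>x. \<bar>f x - g x\<bar> \<partial>M k)" by (rule integral_abs_bound)
      also have "\<dots> \<le> e"
        using that by (intro integral_le_const) auto
      finally show ?thesis .
    qed
    show ?thesis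
      using N[OF that] le[OF int(1,3) near] le[OF int(2,4) near] unfolding e_def by linarith
  qed
  then show "\<exists>no. \<forall>k\<ge>no. norm ((\<integral>x. \<phi> (x + h) \<partial>M k) - (\<integral>x. \<phi> x \<partial>M k) - 0) < r"
    by auto
qed

text \<open>Jensen's inequality for \<open>ln\<close>, from the tangent line of \<open>ln\<close> at the mean.\<close>

lemma (in prob_space) integral_ln_le:
  fixes f :: "'a \<Rightarrow> real"
  assumes [measurable]: "f \<in> borel_measurable M" and \<alpha>: "0 < \<alpha>" and f: "\<And>x. \<alpha> \<le> f x" "\<And>x. f x \<le> C"
  shows "integrable M (\<lambda>x. ln (f x))" and "(\<integral>x. ln (f x) \<partial>M) \<le> ln (\<integral>x. f x \<partial>M)"
proof -
  have C: "\<alpha> \<le> C" using f[of undefined] by linarith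
  have ln_bound: "\<bar>ln (f x)\<bar> \<le> \<bar>ln \<alpha>\<bar> + \<bar>ln C\<bar>" for x
  proof -
    have "ln \<alpha> \<le> ln (f x)" "ln (f x) \<le> ln C"
      using f[of x] \<alpha> C by (auto intro!: ln_mono)
    then show ?thesis by linarith
  qed
  show int: "integrable M (\<lambda>x. ln (f x))"
    by (rule integrable_const_bound[where B = "\<bar>ln \<alpha>\<bar> + \<bar>ln C\<bar>"]) (use ln_bound in auto)
  have "\<bar>f x\<bar> \<le> C" for x using f[of x] \<alpha> by linarith
  then have intf: "integrable M f"
    by (intro integrable_const_bound[where B = C]) auto
  define u where "u = (\<integral>x. f x \<partial>M)"
  have "\<alpha> \<le> u" unfolding u_def using f intf by (intro integral_ge_const) auto
  then have u: "0 < u" using \<alpha> by simp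
  have "(\<integral>x. ln (f x) \<partial>M) \<le> (\<integral>x. ln u + (f x / u - 1) \<partial>M)"
  proof (rule integral_mono)
    fix x
    have "ln (f x / u) \<le> f x / u - 1" using f(1)[of x] \<alpha> u by (intro ln_le_minus_one) auto
    moreover have "ln (f x / u) = ln (f x) - ln u"
      using f(1)[of x] \<alpha> u by (intro ln_divide_pos) auto
    ultimately show "ln (f x) \<le> ln u + (f x / u - 1)" by simp
  qed (use int intf in auto)
  also have "\<dots> = ln u" using intf u by (simp add: prob_space u_def[symmetric])
  finally show "(\<integral>x. ln (f x) \<partial>M) \<le> ln (\<integral>x. f x \<partial>M)" unfolding u_def .
qed

text \<open>Almost minimizers of the \<open>L\<^sup>2\<close> norm over a decreasing sequence of midpoint convex sets
  form an \<open>L\<^sup>2\<close> Cauchy sequence, by the parallelogram identity: the midpoint of two of them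
  still lies in the larger set and cannot have a much smaller norm. For uniformly bounded
  functions this extracts almost everywhere convergence where weak compactness would only
  give weak convergence.\<close>

lemma (in prob_space) midpoint_convex_ae_convergent:
  fixes \<C> :: "nat \<Rightarrow> ('a \<Rightarrow> real) set"
  assumes dec: "decseq \<C>" and ne: "\<And>n. \<C> n \<noteq> {}"
    and meas: "\<And>n u. u \<in> \<C> n \<Longrightarrow> u \<in> borel_measurable M"
    and bound: "\<And>n u x. u \<in> \<C> n \<Longrightarrow> \<bar>u x\<bar> \<le> C"
    and mid: "\<And>n u v. u \<in> \<C> n \<Longrightarrow> v \<in> \<C> n \<Longrightarrow> (\<lambda>x. (u x + v x) / 2) \<in> \<C> n"
  shows "\<exists>v. (\<forall>n. v n \<in> \<C> n) \<and> (AE x in M. convergent (\<lambda>n. v n x))"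
proof -
  define J where "J u = (\<integral>x. (u x)\<^sup>2 \<partial>M)" for u :: "'a \<Rightarrow> real"
  define d where "d n = (INF u\<in>\<C> n. J u)" for n
  have sq: "integrable M (\<lambda>x. (u x)\<^sup>2)" if "u \<in> \<C> n" for u n
  proof (rule integrable_const_bound)
    show "AE x in M. norm ((u x)\<^sup>2) \<le> C\<^sup>2"
      using bound[OF that] by (auto simp: abs_le_square_iff[symmetric] intro!: AE_I2 order_trans[OF _ abs_ge_self])
    show "(\<lambda>x. (u x)\<^sup>2) \<in> borel_measurable M" using meas[OF that] by measurable
  qed
  have J_nonneg: "0 \<le> J u" for u unfolding J_def by simp
  have J_le: "J u \<le> C\<^sup>2" if "u \<in> \<C> n" for u n
    unfolding J_def using sq[OF that] bound[OF that]
    by (intro integral_le_const) (auto simp: abs_le_square_iff[symmetric] intro!: AE_I2 order_trans[OF _ abs_ge_self])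
  have bdd: "bdd_below (J ` \<C> n)" for n using J_nonneg by (intro bdd_belowI[of _ 0]) auto
  have d_le: "d n \<le> J u" if "u \<in> \<C> n" for u n
    unfolding d_def using bdd that by (rule cINF_lower)
  have "incseq d"
    unfolding d_def by (intro incseq_SucI cINF_superset_mono) (use ne bdd dec in \<open>auto simp: decseq_Suc_iff\<close>)
  moreover have "d n \<le> C\<^sup>2" for n
    using ne[of n] d_le J_le by (meson all_not_in_conv order_trans)
  ultimately have "convergent d"
    by (meson incseq_convergent convergentI)
  then have cauchy: "Cauchy d" by (rule convergent_Cauchy)
  define \<rho> :: "nat \<Rightarrow> real" where "\<rho> n = 1 / Suc n" for n
  have "\<exists>u\<in>\<C> n. J u < d n + \<rho> n" for n
  proof -
    have "(INF u\<in>\<C> n. J u) < d n + \<rho> n" by (simp add: d_def \<rho>_def)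
    then show ?thesis using ne[of n] bdd[of n] by (subst (asm) cINF_less_iff) auto
  qed
  then obtain w where w: "\<And>n. w n \<in> \<C> n" "\<And>n. J (w n) < d n + \<rho> n" by metis
  have w_meas [measurable]: "w n \<in> borel_measurable M" for n using meas[OF w(1)] .
  have int: "integrable M (\<lambda>x. \<bar>w n x - w k x\<bar>)" "integrable M (\<lambda>x. (w n x - w k x)\<^sup>2)" for n k
  proof -
    have *: "\<bar>w n x - w k x\<bar> \<le> 2 * C" for x
      using bound[OF w(1), of n x] bound[OF w(1), of k x] by linarith
    show "integrable M (\<lambda>x. \<bar>w n x - w k x\<bar>)"
      by (rule integrable_const_bound[where B = "2 * C"]) (use * in auto)
    show "integrable M (\<lambda>x. (w n x - w k x)\<^sup>2)"
      by (rule integrable_const_bound[where B = "(2 * C)\<^sup>2"])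
        (use abs_le_square_iff[THEN iffD1, OF order_trans[OF * abs_ge_self]] in auto)
  qed
  have par: "J (\<lambda>x. w n x - w k x) \<le> 2 * d k - 2 * d n + 2 * \<rho> n + 2 * \<rho> k" if "n \<le> k" for n k
  proof -
    have wk: "w k \<in> \<C> n" using decseqD[OF dec that] w(1) by blast
    have m: "(\<lambda>x. (w n x + w k x) / 2) \<in> \<C> n" by (rule mid[OF w(1) wk])
    have "J (\<lambda>x. w n x - w k x) = (\<integral>x. 2 * (w n x)\<^sup>2 + 2 * (w k x)\<^sup>2 - 4 * ((w n x + w k x) / 2)\<^sup>2 \<partial>M)"
      unfolding J_def by (intro Bochner_Integration.integral_cong) (auto simp: power2_eq_square field_simps)
    also have "\<dots> = 2 * J (w n) + 2 * J (w k) - 4 * J (\<lambda>x. (w n x + w k x) / 2)"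
      unfolding J_def using sq[OF w(1)[of n]] sq[OF wk] sq[OF m] by (subst Bochner_Integration.integral_diff) auto
    also have "\<dots> \<le> 2 * (d n + \<rho> n) + 2 * (d k + \<rho> k) - 4 * d n"
      using w(2)[of n, THEN less_imp_le] w(2)[of k, THEN less_imp_le] d_le[OF m]
      by (intro diff_mono add_mono mult_left_mono) simp_all
    finally show ?thesis by (simp add: algebra_simps)
  qed
  have small: "\<exists>N. \<forall>n\<ge>N. \<forall>k\<ge>N. (LINT x|M. norm (w n x - w k x)) < e" if "0 < e" for e
  proof -
    define \<epsilon> where "\<epsilon> = e / 2"
    have \<epsilon>: "0 < \<epsilon>" using that by (simp add: \<epsilon>_def)
    have "0 < \<epsilon>\<^sup>2 / 6" using \<epsilon> by simp
    then obtain N1 where N1: "dist (d k) (d n) < \<epsilon>\<^sup>2 / 6" if "n \<ge> N1" "k \<ge> N1" for n k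
      using cauchy unfolding Cauchy_def by metis
    obtain N2 where N2: "\<rho> N2 < \<epsilon>\<^sup>2 / 6"
      using \<open>0 < \<epsilon>\<^sup>2 / 6\<close> nat_approx_posE unfolding \<rho>_def by metis
    have le: "(LINT x|M. norm (w n x - w k x)) < e" if "max N1 N2 \<le> n" "n \<le> k" for n k
    proof -
      have "\<rho> n \<le> \<rho> N2" "\<rho> k \<le> \<rho> N2"
        using that unfolding \<rho>_def by (auto intro!: divide_left_mono)
      moreover have "d k - d n < \<epsilon>\<^sup>2 / 6"
        using N1[of n k] that unfolding dist_real_def by linarith
      ultimately have "J (\<lambda>x. w n x - w k x) \<le> \<epsilon>\<^sup>2"
        using par[OF \<open>n \<le> k\<close>] N2 by linarith
      then have J\<epsilon>: "J (\<lambda>x. w n x - w k x) / \<epsilon> \<le> \<epsilon>"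
        using \<epsilon> by (simp add: power2_eq_square field_simps)
      \<comment> \<open>\<open>L\<^sup>1\<close> is controlled by \<open>L\<^sup>2\<close> through \<open>2 * t * \<epsilon> \<le> t\<^sup>2 + \<epsilon>\<^sup>2\<close>\<close>
      have "(LINT x|M. norm (w n x - w k x)) \<le> (\<integral>x. (\<epsilon> + (w n x - w k x)\<^sup>2 / \<epsilon>) / 2 \<partial>M)"
      proof (rule integral_mono)
        fix x
        have "0 \<le> (\<bar>w n x - w k x\<bar> - \<epsilon>)\<^sup>2" by simp
        then have "2 * \<bar>w n x - w k x\<bar> * \<epsilon> \<le> (w n x - w k x)\<^sup>2 + \<epsilon>\<^sup>2"
          by (simp add: power2_diff algebra_simps)
        then show "norm (w n x - w k x) \<le> (\<epsilon> + (w n x - w k x)\<^sup>2 / \<epsilon>) / 2"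
          using \<epsilon> by (simp add: field_simps power2_eq_square)
      qed (use int in auto)
      also have "\<dots> = (\<epsilon> + J (\<lambda>x. w n x - w k x) / \<epsilon>) / 2"
        unfolding J_def using int by (simp add: prob_space)
      also have "\<dots> \<le> \<epsilon>" using J\<epsilon> by simp
      also have "\<dots> < e" using \<epsilon> by (simp add: \<epsilon>_def)
      finally show ?thesis .
    qed
    have "(LINT x|M. norm (w n x - w k x)) < e" if "max N1 N2 \<le> n" "max N1 N2 \<le> k" for n k
    proof (cases "n \<le> k")
      case False
      have "(LINT x|M. norm (w n x - w k x)) = (LINT x|M. norm (w k x - w n x))"
        by (intro Bochner_Integration.integral_cong refl norm_minus_commute)
      then show ?thesis using le[of k n] that False by simp
    qed (use le that in simp)
    then show ?thesis by blast
  qed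
  have "integrable M (w n)" for n
    by (rule integrable_const_bound[where B = C]) (use bound[OF w(1)] in auto)
  with small obtain r where r: "strict_mono r" "AE x in M. Cauchy (\<lambda>i. w (r i) x)"
    using cauchy_L1_AE_cauchy_subseq[of M w] by metis
  have "w (r n) \<in> \<C> n" for n
    using decseqD[OF dec seq_suble[OF r(1)]] w(1) by blast
  moreover have "AE x in M. convergent (\<lambda>n. w (r n) x)"
    using r(2) by (auto simp: Cauchy_convergent_iff)
  ultimately show ?thesis by (intro exI[of _ "\<lambda>n. w (r n)"]) auto
qed

text \<open>An asymptotically invariant sequence is replaced by an exactly invariant function with the
  same bounds and the same two integral constraints. All properties of \<open>u k\<close> that matter are
  preserved under midpoints, including the bound on the oscillation along orbits, so
  \<open>midpoint_convex_ae_convergent\<close> yields an almost everywhere convergent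
  sequence with these properties. Its limit, where it exists, is invariant at every point,
  since the oscillation tends to \<open>0\<close> at every point and the set of convergence is invariant.\<close>

lemma ae_invariant_limit:
  fixes P Q :: "'y::topological_space measure" and a :: "'g \<Rightarrow> 'y \<Rightarrow> 'y" and u :: "nat \<Rightarrow> 'y \<Rightarrow> real"
  assumes P: "prob_space P" "sets P = sets borel" and Q: "prob_space Q" "sets Q = sets borel"
    and ac: "\<And>R. (AE x in Q. R x) \<Longrightarrow> (AE x in P. R x)"
    and u: "\<And>k. u k \<in> borel_measurable borel" and \<alpha>: "0 < \<alpha>"
    and bounds: "\<And>k x. \<alpha> \<le> u k x" "\<And>k x. u k x \<le> C"
    and int_P: "\<And>k. (\<integral>x. u k x \<partial>P) \<le> 1" and int_Q: "\<And>k. c \<le> (\<integral>x. ln (u k x) \<partial>Q)"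
    and asymp: "\<And>h x. (\<lambda>k. u k (a h x) - u k x) \<longlonglongrightarrow> 0"
  shows "\<exists>v \<in> borel_measurable borel. (\<forall>x. \<alpha> \<le> v x \<and> v x \<le> C) \<and> (\<forall>h x. v (a h x) = v x) \<and>
    (\<integral>x. v x \<partial>P) \<le> 1 \<and> c \<le> (\<integral>x. ln (v x) \<partial>Q)"
proof -
  interpret P: prob_space P by fact
  interpret Q: prob_space Q by fact
  note P(2)[measurable_cong] Q(2)[measurable_cong]
  \<comment> \<open>Quantifying over the bounds \<open>b\<close> states that \<open>v\<close> oscillates along orbits by at most
    the supremum of the oscillations of \<open>u k\<close> with \<open>k \<ge> n\<close>.\<close>
  define \<C> where "\<C> n = {v \<in> borel_measurable borel. (\<forall>x. \<alpha> \<le> v x \<and> v x \<le> C) \<and>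
      (\<integral>x. v x \<partial>P) \<le> 1 \<and> c \<le> (\<integral>x. ln (v x) \<partial>Q) \<and>
      (\<forall>h x b. (\<forall>k\<ge>n. \<bar>u k (a h x) - u k x\<bar> \<le> b) \<longrightarrow> \<bar>v (a h x) - v x\<bar> \<le> b)}" for n :: nat
  have abs: "\<bar>v x\<bar> \<le> C" if "\<alpha> \<le> v x" "v x \<le> C" for v :: "'y \<Rightarrow> real" and x
    using that \<alpha> by linarith
  have "\<exists>v. (\<forall>n. v n \<in> \<C> n) \<and> (AE x in Q. convergent (\<lambda>n. v n x))"
  proof (rule Q.midpoint_convex_ae_convergent)
    show "decseq \<C>"
      unfolding decseq_def
    proof (intro allI impI subsetI)
      fix m n :: nat and v assume "m \<le> n" "v \<in> \<C> n"
      then show "v \<in> \<C> m"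
        unfolding \<C>_def mem_Collect_eq by (meson order_trans)
    qed
    show "\<C> n \<noteq> {}" for n
    proof -
      have "u n \<in> \<C> n" unfolding \<C>_def using u bounds int_P int_Q by auto
      then show ?thesis by blast
    qed
    show "v \<in> borel_measurable Q" if "v \<in> \<C> n" for v n
    proof -
      have [measurable]: "v \<in> borel_measurable borel" using that by (simp add: \<C>_def)
      show ?thesis by measurable
    qed
    show "\<bar>v x\<bar> \<le> C" if "v \<in> \<C> n" for v n x
      using that abs unfolding \<C>_def by blast
    show "(\<lambda>x. (v x + w x) / 2) \<in> \<C> n" if "v \<in> \<C> n" "w \<in> \<C> n" for v w n
    proof -
      have v [measurable]: "v \<in> borel_measurable borel"
        and v_b: "\<alpha> \<le> v x" "v x \<le> C"
        and v_int: "(\<integral>x. v x \<partial>P) \<le> 1" "c \<le> (\<integral>x. ln (v x) \<partial>Q)"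
        and v_osc: "\<And>b. (\<forall>k\<ge>n. \<bar>u k (a h x) - u k x\<bar> \<le> b) \<Longrightarrow> \<bar>v (a h x) - v x\<bar> \<le> b" for h x
        using that(1) unfolding \<C>_def mem_Collect_eq by blast+
      have w [measurable]: "w \<in> borel_measurable borel"
        and w_b: "\<alpha> \<le> w x" "w x \<le> C"
        and w_int: "(\<integral>x. w x \<partial>P) \<le> 1" "c \<le> (\<integral>x. ln (w x) \<partial>Q)"
        and w_osc: "\<And>b. (\<forall>k\<ge>n. \<bar>u k (a h x) - u k x\<bar> \<le> b) \<Longrightarrow> \<bar>w (a h x) - w x\<bar> \<le> b" for h x
        using that(2) unfolding \<C>_def mem_Collect_eq by blast+
      have avg: "\<alpha> \<le> (v x + w x) / 2" "(v x + w x) / 2 \<le> C" for x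
        using v_b[of x] w_b[of x] by auto
      have "\<bar>v x\<bar> \<le> C" "\<bar>w x\<bar> \<le> C" for x
        using abs[of v x, OF v_b] abs[of w x, OF w_b] by auto
      then have "integrable P v" "integrable P w"
        by (intro P.integrable_const_bound[where B = C]; simp)+
      then have "(\<integral>x. (v x + w x) / 2 \<partial>P) \<le> 1"
        using v_int(1) w_int(1) by simp
      moreover have "c \<le> (\<integral>x. ln ((v x + w x) / 2) \<partial>Q)"
      proof -
        have v_ln: "integrable Q (\<lambda>x. ln (v x))" and w_ln: "integrable Q (\<lambda>x. ln (w x))"
          and a_ln: "integrable Q (\<lambda>x. ln ((v x + w x) / 2))"
          using \<alpha> v_b w_b avg by (intro Q.integral_ln_le(1)[of _ \<alpha> C]; simp)+
        have "c \<le> (\<integral>x. (ln (v x) + ln (w x)) / 2 \<partial>Q)"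
          using v_ln w_ln v_int(2) w_int(2) by simp
        also have "\<dots> \<le> (\<integral>x. ln ((v x + w x) / 2) \<partial>Q)"
        proof (rule integral_mono)
          fix x
          have pos: "0 < v x" "0 < w x" using v_b[of x] w_b[of x] \<alpha> by auto
          then have "ln (sqrt (v x * w x)) \<le> ln ((v x + w x) / 2)"
            by (intro ln_mono arith_geo_mean_sqrt) auto
          then show "(ln (v x) + ln (w x)) / 2 \<le> ln ((v x + w x) / 2)"
            using pos by (simp add: ln_sqrt ln_mult)
        qed (use v_ln w_ln a_ln in auto)
        finally show ?thesis .
      qed
      moreover have "\<bar>(v (a h x) + w (a h x)) / 2 - (v x + w x) / 2\<bar> \<le> b"
        if "\<forall>k\<ge>n. \<bar>u k (a h x) - u k x\<bar> \<le> b" for h x b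
      proof -
        have eq: "(v (a h x) + w (a h x)) / 2 - (v x + w x) / 2 = ((v (a h x) - v x) + (w (a h x) - w x)) / 2"
          by (simp add: field_simps)
        have "\<bar>(v (a h x) - v x) + (w (a h x) - w x)\<bar> \<le> b * 2"
          using v_osc[OF that] w_osc[OF that] by linarith
        then show ?thesis unfolding eq by simp
      qed
      ultimately show ?thesis
        unfolding \<C>_def mem_Collect_eq using avg by (intro conjI allI impI) (simp_all, measurable)
    qed
  qed
  then obtain v where v: "\<And>n. v n \<in> \<C> n" and conv: "AE x in Q. convergent (\<lambda>n. v n x)" by blast
  have v_meas [measurable]: "v n \<in> borel_measurable borel"
    and v_b: "\<alpha> \<le> v n x" "v n x \<le> C"
    and v_int: "(\<integral>x. v n x \<partial>P) \<le> 1" "c \<le> (\<integral>x. ln (v n x) \<partial>Q)"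
    and v_osc: "\<And>b. (\<forall>k\<ge>n. \<bar>u k (a h x) - u k x\<bar> \<le> b) \<Longrightarrow> \<bar>v n (a h x) - v n x\<bar> \<le> b" for n h x
    using v[of n] unfolding \<C>_def mem_Collect_eq by blast+
  have asymp_v: "(\<lambda>n. v n (a h x) - v n x) \<longlonglongrightarrow> 0" for h x
  proof (rule LIMSEQ_I)
    fix r :: real assume "0 < r"
    then obtain N where N: "\<bar>u k (a h x) - u k x\<bar> < r / 2" if "k \<ge> N" for k
      using LIMSEQ_D[OF asymp[of h x], of "r / 2"] by auto
    have "\<bar>v n (a h x) - v n x\<bar> < r" if "n \<ge> N" for n
    proof -
      have "\<bar>v n (a h x) - v n x\<bar> \<le> r / 2"
        using N that by (intro v_osc) (meson less_imp_le order_trans)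
      then show ?thesis using \<open>0 < r\<close> by linarith
    qed
    then show "\<exists>N. \<forall>n\<ge>N. norm (v n (a h x) - v n x - 0) < r" by auto
  qed
  \<comment> \<open>any constant in the range keeps the function invariant and within its bounds off the set of convergence\<close>
  define V where "V x = (if convergent (\<lambda>n. v n x) then lim (\<lambda>n. v n x) else \<alpha>)" for x
  have V_meas: "V \<in> borel_measurable borel"
  proof -
    have [measurable]: "Measurable.pred borel (\<lambda>x. convergent (\<lambda>n. v n x))"
      unfolding Cauchy_convergent_iff[symmetric] by measurable
    show ?thesis unfolding V_def by measurable
  qed
  have tendsto_V: "(\<lambda>n. v n x) \<longlonglongrightarrow> V x" if "convergent (\<lambda>n. v n x)" for x
    using that by (simp add: V_def convergent_LIMSEQ_iff)
  have C: "\<alpha> \<le> C" using order_trans[OF v_b] .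
  have V_b: "\<alpha> \<le> V x \<and> V x \<le> C" for x
  proof (cases "convergent (\<lambda>n. v n x)")
    case True
    from tendsto_V[OF this] show ?thesis
      using v_b by (intro conjI LIMSEQ_le_const LIMSEQ_le_const2) auto
  qed (simp add: V_def C)
  have V_inv: "V (a h x) = V x" for h x
  proof (cases "convergent (\<lambda>n. v n x)")
    case True
    have "(\<lambda>n. (v n (a h x) - v n x) + v n x) \<longlonglongrightarrow> 0 + V x"
      by (intro tendsto_add asymp_v tendsto_V True)
    then have lim: "(\<lambda>n. v n (a h x)) \<longlonglongrightarrow> V x" by simp
    then have "convergent (\<lambda>n. v n (a h x))" by (rule convergentI)
    from LIMSEQ_unique[OF tendsto_V[OF this] lim] show ?thesis .
  next
    case False
    have "\<not> convergent (\<lambda>n. v n (a h x))"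
    proof
      assume "convergent (\<lambda>n. v n (a h x))"
      from tendsto_diff[OF tendsto_V[OF this] asymp_v[of h x]]
      have "convergent (\<lambda>n. v n x)" by (auto intro: convergentI)
      with False show False ..
    qed
    with False show ?thesis by (simp add: V_def)
  qed
  have "(\<lambda>n. \<integral>x. v n x \<partial>P) \<longlonglongrightarrow> (\<integral>x. V x \<partial>P)"
  proof (rule integral_dominated_convergence[where w = "\<lambda>_. C"])
    show "AE x in P. (\<lambda>n. v n x) \<longlonglongrightarrow> V x"
      using ac[OF conv] by eventually_elim (rule tendsto_V)
    show "AE x in P. norm (v n x) \<le> C" for n using abs[of "v n", OF v_b] by simp
  qed (use V_meas in simp_all)
  then have V_P: "(\<integral>x. V x \<partial>P) \<le> 1" by (rule LIMSEQ_le_const2) (use v_int in auto)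
  have "(\<lambda>n. \<integral>x. ln (v n x) \<partial>Q) \<longlonglongrightarrow> (\<integral>x. ln (V x) \<partial>Q)"
  proof (rule integral_dominated_convergence[where w = "\<lambda>_. \<bar>ln \<alpha>\<bar> + \<bar>ln C\<bar>"])
    show "AE x in Q. (\<lambda>n. ln (v n x)) \<longlonglongrightarrow> ln (V x)"
      using conv
    proof eventually_elim
      case (elim x)
      then show ?case using V_b[of x] \<alpha> by (intro tendsto_ln tendsto_V) auto
    qed
    have "norm (ln (v n x)) \<le> \<bar>ln \<alpha>\<bar> + \<bar>ln C\<bar>" for n x
    proof -
      have "ln \<alpha> \<le> ln (v n x)" "ln (v n x) \<le> ln C"
        using v_b[of n x] \<alpha> C by (auto intro!: ln_mono)
      then show ?thesis by auto
    qed
    then show "AE x in Q. norm (ln (v n x)) \<le> \<bar>ln \<alpha>\<bar> + \<bar>ln C\<bar>" for n by simp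
  qed (use V_meas in simp_all)
  then have V_Q: "c \<le> (\<integral>x. ln (V x) \<partial>Q)" by (rule LIMSEQ_le_const) (use v_int in auto)
  show ?thesis
    using V_meas V_b V_inv V_P V_Q by blast
qed

text \<open>Averaging \<open>s (a g x)\<close> over \<open>g\<close> with the measures that witness amenability keeps the
  constraint under \<open>P\<close> by Fubini and the growth under \<open>Q\<close> by concavity of \<open>ln\<close>. The averages
  are asymptotically invariant at every point: moving \<open>x\<close> to \<open>a h x\<close> replaces \<open>g\<close> by
  \<open>g + h\<close>, which is the translation that amenability controls.\<close>

lemma averaged_orbit_limit:
  fixes a :: "'g::{topological_group_add, second_countable_topology} \<Rightarrow> 'y::second_countable_topology \<Rightarrow> 'y"
    and P Q :: "'y measure" and s :: "'y \<Rightarrow> real"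
  assumes amenable: "amenable TYPE('g)"
    and act: "is_action a" and cont: "continuous_action a"
    and P: "prob_space P" "sets P = sets borel" and Q: "prob_space Q" "sets Q = sets borel"
    and ac: "\<And>R. (AE x in Q. R x) \<Longrightarrow> (AE x in P. R x)"
    and s [measurable]: "s \<in> borel_measurable borel" and \<alpha>: "0 < \<alpha>"
    and bounds: "\<And>x. \<alpha> \<le> s x" "\<And>x. s x \<le> C"
    and int_P: "\<And>g. (\<integral>x. s (a g x) \<partial>P) \<le> 1" and int_Q: "\<And>g. c \<le> (\<integral>x. ln (s (a g x)) \<partial>Q)"
  shows "\<exists>v \<in> borel_measurable borel. (\<forall>x. \<alpha> \<le> v x \<and> v x \<le> C) \<and> (\<forall>h x. v (a h x) = v x) \<and>
    (\<integral>x. v x \<partial>P) \<le> 1 \<and> c \<le> (\<integral>x. ln (v x) \<partial>Q)"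
proof -
  obtain M :: "nat \<Rightarrow> 'g measure" where M: "\<And>k. prob_space (M k)" "\<And>k. sets (M k) = sets borel"
    and lim: "\<And>B g. B \<in> sets borel \<Longrightarrow>
      (\<lambda>k. \<bar>measure (M k) B - measure (M k) ((\<lambda>h. h + g) ` B)\<bar>) \<longlonglongrightarrow> 0"
    using amenable unfolding amenable_def by metis
  have a_meas [measurable]: "(\<lambda>(g, x). a g x) \<in> borel \<Otimes>\<^sub>M borel \<rightarrow>\<^sub>M borel"
    using cont unfolding continuous_action_def borel_prod by (rule borel_measurable_continuous_onI)
  have C: "\<alpha> \<le> C" using order_trans[OF bounds] .
  have s_abs: "\<bar>s x\<bar> \<le> C" for x using bounds[of x] \<alpha> by linarith
  have ln_abs: "\<bar>ln (s x)\<bar> \<le> \<bar>ln \<alpha>\<bar> + \<bar>ln C\<bar>" for x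
  proof -
    have "ln \<alpha> \<le> ln (s x)" "ln (s x) \<le> ln C"
      using bounds[of x] \<alpha> C by (auto intro!: ln_mono)
    then show ?thesis by linarith
  qed
  define u where "u k x = (\<integral>g. s (a g x) \<partial>M k)" for k x
  show ?thesis
  proof (rule ae_invariant_limit[OF P Q _ _ \<alpha>])
    fix k
    interpret M: prob_space "M k" by fact
    interpret P: prob_space P by fact
    interpret Q: prob_space Q by fact
    interpret MP: pair_prob_space "M k" P ..
    interpret MQ: pair_prob_space "M k" Q ..
    note M(2)[of k, measurable_cong] P(2)[measurable_cong] Q(2)[measurable_cong]
    show u_meas: "u k \<in> borel_measurable borel"
    proof -
      have "(\<lambda>(x, g). s (a g x)) \<in> borel_measurable (borel \<Otimes>\<^sub>M M k)" by measurable
      then show ?thesis unfolding u_def by measurable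
    qed
    have int_s: "integrable (M k) (\<lambda>g. s (a g x))" for x
      by (rule M.integrable_const_bound[where B = C]) (use s_abs in auto)
    show u_b: "\<alpha> \<le> u k x" "u k x \<le> C" for x
      unfolding u_def using int_s bounds by (auto intro!: M.integral_ge_const M.integral_le_const)
    have "(\<integral>x. u k x \<partial>P) = (\<integral>g. (\<integral>x. s (a g x) \<partial>P) \<partial>M k)"
      unfolding u_def
      by (rule MP.Fubini_integral)
        (rule MP.P.integrable_const_bound[where B = C]; use s_abs in \<open>auto simp: split_beta'\<close>)
    also have "\<dots> \<le> 1"
    proof (rule M.integral_le_const)
      show "integrable (M k) (\<lambda>g. \<integral>x. s (a g x) \<partial>P)"
      proof (rule M.integrable_const_bound[where B = 1])
        have "0 \<le> (\<integral>x. s (a g x) \<partial>P)" for g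
          using bounds(1) \<alpha> by (intro integral_nonneg_AE AE_I2) (meson less_imp_le order_trans)
        then show "AE g in M k. norm (\<integral>x. s (a g x) \<partial>P) \<le> 1" using int_P by simp
      qed measurable
    qed (use int_P in simp)
    finally show "(\<integral>x. u k x \<partial>P) \<le> 1" .
    have int_ln: "integrable (M k \<Otimes>\<^sub>M Q) (\<lambda>(g, x). ln (s (a g x)))"
      by (rule MQ.P.integrable_const_bound[where B = "\<bar>ln \<alpha>\<bar> + \<bar>ln C\<bar>"])
        (use ln_abs in \<open>auto simp: split_beta'\<close>)
    have "c \<le> (\<integral>g. (\<integral>x. ln (s (a g x)) \<partial>Q) \<partial>M k)"
      using int_Q MQ.integrable_fst[OF int_ln] by (intro M.integral_ge_const) auto
    also have "\<dots> = (\<integral>x. (\<integral>g. ln (s (a g x)) \<partial>M k) \<partial>Q)"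
      by (rule MQ.Fubini_integral[symmetric]) (rule int_ln)
    also have "\<dots> \<le> (\<integral>x. ln (u k x) \<partial>Q)"
    proof (rule integral_mono)
      show "integrable Q (\<lambda>x. \<integral>g. ln (s (a g x)) \<partial>M k)"
        using MQ.integrable_snd[OF int_ln] .
      show "integrable Q (\<lambda>x. ln (u k x))"
        by (rule Q.integral_ln_le(1)[OF _ \<alpha> u_b]) (use u_meas in measurable)
      show "(\<integral>g. ln (s (a g x)) \<partial>M k) \<le> ln (u k x)" for x
        unfolding u_def by (rule M.integral_ln_le(2)[OF _ \<alpha> bounds]) measurable
    qed
    finally show "c \<le> (\<integral>x. ln (u k x) \<partial>Q)" .
  next
    fix h :: 'g and x :: 'y
    have "(\<lambda>g. s (a g x)) \<in> borel_measurable borel" by measurable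
    from amenable_integral_shift[OF M lim this s_abs, of h]
    show "(\<lambda>k. u k (a h x) - u k x) \<longlonglongrightarrow> 0"
      using act unfolding u_def is_action_def by simp
  qed (rule ac)
qed

section \<open>Expected logarithms under finite Kullback-Leibler divergence\<close>

text \<open>The excess of \<open>ln s\<close> over the truncation level \<open>ln C\<close>, when \<open>f\<close> is a likelihood ratio of
  \<open>Q\<close> to \<open>P\<close>. Beyond the level, \<open>ln (s / C)\<close> is at most \<open>s / (C * f) + \<bar>ln f\<bar>\<close>; if
  \<open>\<bar>ln f\<bar> \<le> N\<close>, then \<open>s / (C * f) \<ge> exp (- N)\<close> there, so \<open>\<bar>ln f\<bar>\<close> itself is at most
  \<open>N * exp N * s / (C * f)\<close>. Since \<open>s / f\<close> has the same integral under \<open>Q\<close> as \<open>s\<close> under \<open>P\<close>,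
  the first term is small for large \<open>C\<close> uniformly over all \<open>s\<close> of \<open>P\<close>-integral at most \<open>1\<close>.\<close>

lemma pos_ln_le:
  fixes s f C N :: real
  assumes s: "0 \<le> s" and f: "0 < f" and C: "0 < C" and N: "0 \<le> N"
  shows "max 0 (ln (s / C)) \<le> (1 + N * exp N) / C * (s / f) + (if N < \<bar>ln f\<bar> then \<bar>ln f\<bar> else 0)"
proof (cases "s \<le> C")
  case True
  have "ln (s / C) \<le> 0"
    using True s C by (cases "s = 0") (auto simp: field_simps)
  moreover have "0 \<le> (1 + N * exp N) / C * (s / f)" using s f C N by auto
  ultimately show ?thesis by auto
next
  case False
  define t where "t = s / (C * f)"
  have t: "0 < t" "s / C = t * f" using False f C unfolding t_def by auto
  have eq: "(1 + N * exp N) / C * (s / f) = t + N * (exp N * t)"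
    using f C by (simp add: t_def field_simps)
  have sC: "1 < s / C" using False C by simp
  then have "0 < ln (s / C)" by simp
  then have "max 0 (ln (s / C)) = ln t + ln f"
    using t f by (simp add: ln_mult_pos)
  also have "\<dots> \<le> t + \<bar>ln f\<bar>" using ln_le_minus_one[OF t(1)] by linarith
  also have "\<dots> \<le> t + N * (exp N * t) + (if N < \<bar>ln f\<bar> then \<bar>ln f\<bar> else 0)"
  proof (cases "N < \<bar>ln f\<bar>")
    case True
    then show ?thesis using t N by simp
  next
    case False
    then have "f \<le> exp N" using f by (metis abs_ge_self exp_ln exp_le_cancel_iff linorder_not_less order_trans)
    then have "t * f \<le> t * exp N" using t(1) by simp
    then have "1 \<le> exp N * t" using sC unfolding t(2) by (simp add: mult.commute)
    then have "N \<le> N * (exp N * t)" using N by (metis mult.right_neutral mult_left_mono)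
    with False show ?thesis by simp
  qed
  finally show ?thesis unfolding eq .
qed

lemma e2ennreal_eln: "0 < t \<Longrightarrow> t < \<top> \<Longrightarrow> e2ennreal (eln t) = ennreal (ln (enn2real t))"
    "0 < t \<Longrightarrow> t < \<top> \<Longrightarrow> e2ennreal (- eln t) = ennreal (- ln (enn2real t))"
  by (auto simp: eln_def)

lemma eln_measurable [measurable]: "eln \<in> borel_measurable borel"
proof -
  have "(\<lambda>t. if t = 0 then - \<infinity> else if t = \<top> then \<infinity> else ereal (ln (enn2real t))) \<in> borel_measurable borel"
    by measurable
  then show ?thesis unfolding eln_def[abs_def] .
qed

lemma expect_ln_eq_integral:
  assumes [measurable]: "T \<in> borel_measurable M"
    and pos: "AE x in M. 0 < T x \<and> T x < \<top>" and int: "integrable M (\<lambda>x. ln (enn2real (T x)))"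
  shows "expect_ln M T = ereal (\<integral>x. ln (enn2real (T x)) \<partial>M)"
proof -
  have eq: "(\<integral>\<^sup>+x. e2ennreal (eln (T x)) \<partial>M) = (\<integral>\<^sup>+x. ennreal (ln (enn2real (T x))) \<partial>M)"
    "(\<integral>\<^sup>+x. e2ennreal (- eln (T x)) \<partial>M) = (\<integral>\<^sup>+x. ennreal (- ln (enn2real (T x))) \<partial>M)"
    by (rule nn_integral_cong_AE; use pos in eventually_elim; simp add: e2ennreal_eln)+
  have fin: "(\<integral>\<^sup>+x. ennreal (ln (enn2real (T x))) \<partial>M) \<noteq> \<top>"
      "(\<integral>\<^sup>+x. ennreal (- ln (enn2real (T x))) \<partial>M) \<noteq> \<top>"
    using int unfolding real_integrable_def by auto
  show ?thesis
    unfolding expect_ln_def eq real_lebesgue_integral_def[OF int]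
    using fin by (cases "\<integral>\<^sup>+x. ennreal (ln (enn2real (T x))) \<partial>M";
        cases "\<integral>\<^sup>+x. ennreal (- ln (enn2real (T x))) \<partial>M") (auto simp: enn2ereal_ennreal)
qed

lemma expect_ln_finite:
  assumes [measurable]: "T \<in> borel_measurable M"
    and fin: "(\<integral>\<^sup>+x. e2ennreal (eln (T x)) \<partial>M) < \<top>" and c: "ereal c \<le> expect_ln M T"
  shows "AE x in M. 0 < T x \<and> T x < \<top>" and "integrable M (\<lambda>x. ln (enn2real (T x)))"
proof -
  have fin': "(\<integral>\<^sup>+x. e2ennreal (- eln (T x)) \<partial>M) < \<top>"
    using c fin unfolding expect_ln_def
    by (cases "\<integral>\<^sup>+x. e2ennreal (eln (T x)) \<partial>M"; cases "\<integral>\<^sup>+x. e2ennreal (- eln (T x)) \<partial>M")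
      (auto simp: enn2ereal_ennreal)
  have "AE x in M. e2ennreal (eln (T x)) \<noteq> \<infinity>" "AE x in M. e2ennreal (- eln (T x)) \<noteq> \<infinity>"
    using fin fin' by (intro nn_integral_noteq_infinite; simp)+
  then show pos: "AE x in M. 0 < T x \<and> T x < \<top>"
    by eventually_elim (auto simp: eln_def zero_less_iff_neq_zero less_top split: if_splits)
  have eq: "(\<integral>\<^sup>+x. e2ennreal (eln (T x)) \<partial>M) = (\<integral>\<^sup>+x. ennreal (ln (enn2real (T x))) \<partial>M)"
    "(\<integral>\<^sup>+x. e2ennreal (- eln (T x)) \<partial>M) = (\<integral>\<^sup>+x. ennreal (- ln (enn2real (T x))) \<partial>M)"
    by (rule nn_integral_cong_AE; use pos in eventually_elim; simp add: e2ennreal_eln)+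
  show "integrable M (\<lambda>x. ln (enn2real (T x)))"
    unfolding real_integrable_def using fin fin' by (auto simp: eq)
qed

lemma expect_ln_distr:
  assumes "h \<in> M \<rightarrow>\<^sub>M N" "T \<in> borel_measurable N"
  shows "expect_ln (distr M N h) T = expect_ln M (\<lambda>x. T (h x))"
  using assms unfolding expect_ln_def by (simp add: nn_integral_distr)

text \<open>Mutually absolutely continuous probability measures with likelihood ratio \<open>f\<close>; the
  integrability of \<open>ln f\<close> under \<open>Q\<close> is finiteness of the Kullback-Leibler divergence.\<close>

locale finite_log_ratio = P: prob_space P + Q: prob_space Q for P Q :: "'y measure" +
  fixes f :: "'y \<Rightarrow> real"
  assumes f_measurable [measurable]: "f \<in> borel_measurable P"
    and Q_eq: "Q = density P (\<lambda>x. ennreal (f x))"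
    and f_pos: "AE x in P. 0 < f x"
    and ln_f: "integrable Q (\<lambda>x. ln (f x))"
begin

lemma AE_iff: "(AE x in Q. R x) \<longleftrightarrow> (AE x in P. R x)"
proof -
  have "(AE x in Q. R x) \<longleftrightarrow> (AE x in P. 0 < f x \<longrightarrow> R x)"
    unfolding Q_eq by (simp add: AE_density)
  also have "\<dots> \<longleftrightarrow> (AE x in P. R x)"
    using f_pos by (auto elim: eventually_elim2)
  finally show ?thesis .
qed

lemma sets_Q [measurable_cong]: "sets Q = sets P" by (simp add: Q_eq)

lemma nn_integral_divide_ratio:
  assumes [measurable]: "T \<in> borel_measurable P"
  shows "(\<integral>\<^sup>+x. T x * ennreal (1 / f x) \<partial>Q) = (\<integral>\<^sup>+x. T x \<partial>P)"
proof -
  have "(\<integral>\<^sup>+x. T x * ennreal (1 / f x) \<partial>Q) = (\<integral>\<^sup>+x. ennreal (f x) * (T x * ennreal (1 / f x)) \<partial>P)"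
    unfolding Q_eq by (rule nn_integral_density) auto
  also have "\<dots> = (\<integral>\<^sup>+x. T x \<partial>P)"
  proof (rule nn_integral_cong_AE, use f_pos in eventually_elim)
    case (elim x)
    have "ennreal (f x) * ennreal (1 / f x) = 1"
      using elim by (simp add: ennreal_mult[symmetric])
    then show "ennreal (f x) * (T x * ennreal (1 / f x)) = T x"
      by (metis mult.left_commute mult.right_neutral)
  qed
  finally show ?thesis .
qed

text \<open>The case \<open>C = 1\<close>, \<open>N = 0\<close> of \<open>pos_ln_le\<close>. Together with the integrability of \<open>ln f\<close> it
  makes the positive part finite, which excludes the convention for \<open>\<infinity> - \<infinity>\<close> from
  the expected logarithm of an e-statistic.\<close>

lemma nn_integral_pos_ln_le:
  assumes [measurable]: "T \<in> borel_measurable P" and T: "(\<integral>\<^sup>+x. T x \<partial>P) \<le> 1"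
  shows "(\<integral>\<^sup>+x. e2ennreal (eln (T x)) \<partial>Q) \<le> 1 + (\<integral>\<^sup>+x. ennreal \<bar>ln (f x)\<bar> \<partial>Q)"
proof -
  have "AE x in Q. e2ennreal (eln (T x)) \<le> T x * ennreal (1 / f x) + ennreal \<bar>ln (f x)\<bar>"
    using f_pos[folded AE_iff]
  proof eventually_elim
    case (elim x)
    show ?case
    proof (cases "T x")
      case (real s)
      have "ln s \<le> s * (1 / f x) + \<bar>ln (f x)\<bar>"
        using pos_ln_le[of s "f x" 1 0] elim real by (auto split: if_splits)
      with real elim show ?thesis
        by (cases "s = 0") (auto simp: eln_def e2ennreal_neg ennreal_mult[symmetric] ennreal_plus[symmetric]
          simp del: ennreal_plus intro!: ennreal_leI)
    next
      case top
      then show ?thesis using elim by (simp add: ennreal_top_mult)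
    qed
  qed
  then have "(\<integral>\<^sup>+x. e2ennreal (eln (T x)) \<partial>Q)
      \<le> (\<integral>\<^sup>+x. T x * ennreal (1 / f x) + ennreal \<bar>ln (f x)\<bar> \<partial>Q)"
    by (rule nn_integral_mono_AE)
  also have "\<dots> = (\<integral>\<^sup>+x. T x \<partial>P) + (\<integral>\<^sup>+x. ennreal \<bar>ln (f x)\<bar> \<partial>Q)"
    by (subst nn_integral_add) (auto simp: nn_integral_divide_ratio)
  also have "\<dots> \<le> 1 + (\<integral>\<^sup>+x. ennreal \<bar>ln (f x)\<bar> \<partial>Q)"
    using T by (rule add_right_mono)
  finally show ?thesis .
qed

lemma nn_integral_abs_ln_ratio: "(\<integral>\<^sup>+x. ennreal \<bar>ln (f x)\<bar> \<partial>Q) < \<top>"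
  using ln_f unfolding integrable_iff_bounded by simp

lemma expect_ln_le:
  assumes "T \<in> borel_measurable P" "(\<integral>\<^sup>+x. T x \<partial>P) \<le> 1"
  shows "expect_ln Q T \<le> enn2ereal (1 + (\<integral>\<^sup>+x. ennreal \<bar>ln (f x)\<bar> \<partial>Q))"
proof -
  have "expect_ln Q T \<le> enn2ereal (\<integral>\<^sup>+x. e2ennreal (eln (T x)) \<partial>Q)"
    unfolding expect_ln_def by (rule ereal_diff_le_self) simp
  also have "\<dots> \<le> enn2ereal (1 + (\<integral>\<^sup>+x. ennreal \<bar>ln (f x)\<bar> \<partial>Q))"
    using nn_integral_pos_ln_le[OF assms] by (simp add: less_eq_ennreal.rep_eq)
  finally show ?thesis .
qed

text \<open>Truncating from above and mixing with the constant \<open>1\<close> turns an e-statistic into one that is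
  bounded and bounded away from \<open>0\<close>, and loses at most \<open>\<eta>\<close> of the expected logarithm. That
  \<open>\<alpha>\<close> and \<open>C\<close> do not depend on \<open>T\<close> permits the same truncation of all translates
  \<open>\<lambda>x. T (a g x)\<close>.\<close>

lemma uniform_truncation:
  assumes \<eta>: "0 < \<eta>"
  shows "\<exists>\<alpha> C. 0 < \<alpha> \<and> \<alpha> < 1 \<and> 0 < C \<and> (\<forall>T. T \<in> borel_measurable P \<longrightarrow> (\<integral>\<^sup>+x. T x \<partial>P) \<le> 1 \<longrightarrow>
    ereal c \<le> expect_ln Q T \<longrightarrow>
      (\<integral>x. (1 - \<alpha>) * enn2real (min (T x) (ennreal C)) + \<alpha> \<partial>P) \<le> 1 \<and>
      c - \<eta> \<le> (\<integral>x. ln ((1 - \<alpha>) * enn2real (min (T x) (ennreal C)) + \<alpha>) \<partial>Q))"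
proof -
  define tail where "tail N x = (if real N < \<bar>ln (f x)\<bar> then \<bar>ln (f x)\<bar> else 0)" for N x
  have tail_meas [measurable]: "tail N \<in> borel_measurable P" for N
    unfolding tail_def by measurable
  have tail_int: "integrable Q (tail N)" for N
    by (rule Bochner_Integration.integrable_bound[OF ln_f]) (auto simp: tail_def)
  have "(\<lambda>N. \<integral>x. tail N x \<partial>Q) \<longlonglongrightarrow> (\<integral>x. 0 \<partial>Q)"
  proof (rule integral_dominated_convergence[where w = "\<lambda>x. \<bar>ln (f x)\<bar>"])
    show "AE x in Q. (\<lambda>N. tail N x) \<longlonglongrightarrow> 0"
    proof (rule AE_I2)
      fix x
      have "tail N x = 0" if "nat \<lceil>\<bar>ln (f x)\<bar>\<rceil> \<le> N" for N
        using that unfolding tail_def by (auto simp: nat_ceiling_le_eq)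
      then show "(\<lambda>N. tail N x) \<longlonglongrightarrow> 0"
        by (intro tendsto_eventually eventually_sequentiallyI)
    qed
  qed (use ln_f in \<open>auto simp: tail_def\<close>)
  from order_tendstoD(2)[OF this, of "\<eta> / 4"] \<eta>
  obtain N where N: "(\<integral>x. tail N x \<partial>Q) < \<eta> / 4"
    by (auto simp: eventually_sequentially)
  \<comment> \<open>Budget for \<open>\<eta>\<close>: a half for the factor \<open>1 - \<alpha>\<close>, a quarter for the tail of \<open>ln f\<close>,
    a quarter for the part of the excess that is proportional to \<open>1 / C\<close>.\<close>
  define K where "K = 1 + real N * exp (real N)"
  have K: "1 \<le> K" by (simp add: K_def)
  define C where "C = 4 * K / \<eta>"
  have C: "0 < C" "K / C = \<eta> / 4" using K \<eta> by (auto simp: C_def)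
  define \<alpha> where "\<alpha> = 1 - exp (- \<eta> / 2)"
  have \<alpha>: "0 < \<alpha>" "\<alpha> < 1" "ln (1 - \<alpha>) = - \<eta> / 2" using \<eta> by (auto simp: \<alpha>_def)
  have "(\<integral>x. (1 - \<alpha>) * enn2real (min (T x) (ennreal C)) + \<alpha> \<partial>P) \<le> 1 \<and>
      c - \<eta> \<le> (\<integral>x. ln ((1 - \<alpha>) * enn2real (min (T x) (ennreal C)) + \<alpha>) \<partial>Q)"
    if [measurable]: "T \<in> borel_measurable P" and T: "(\<integral>\<^sup>+x. T x \<partial>P) \<le> 1" and c: "ereal c \<le> expect_ln Q T" for T
  proof
    define t where "t x = enn2real (T x)" for x
    define r where "r x = enn2real (min (T x) (ennreal C))" for x
    have [measurable]: "t \<in> borel_measurable P" "r \<in> borel_measurable P"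
      unfolding t_def r_def by measurable
    have r: "0 \<le> r x" "r x \<le> C" "ennreal (r x) \<le> T x" for x
    proof -
      have "r x \<le> enn2real (ennreal C)" unfolding r_def by (intro enn2real_mono) auto
      then show "r x \<le> C" using C by simp
      have "ennreal (r x) = min (T x) (ennreal C)"
        unfolding r_def by (rule ennreal_enn2real) (simp add: min_less_iff_disj)
      then show "ennreal (r x) \<le> T x" by simp
    qed (simp add: r_def)
    have int_r: "integrable P r"
      by (rule P.integrable_const_bound[where B = C]) (use r in auto)
    have "ennreal (\<integral>x. r x \<partial>P) = (\<integral>\<^sup>+x. ennreal (r x) \<partial>P)"
      by (rule nn_integral_eq_integral[symmetric]) (use int_r r in auto)
    also have "\<dots> \<le> 1" using T r(3) by (meson nn_integral_mono order_trans)
    finally have "(\<integral>x. r x \<partial>P) \<le> 1" by simp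
    then have "(1 - \<alpha>) * (\<integral>x. r x \<partial>P) \<le> 1 - \<alpha>" using \<alpha> mult_left_le by fastforce
    then show "(\<integral>x. (1 - \<alpha>) * enn2real (min (T x) (ennreal C)) + \<alpha> \<partial>P) \<le> 1"
      unfolding r_def[symmetric] using int_r by (simp add: P.prob_space)
    have fin: "(\<integral>\<^sup>+x. e2ennreal (eln (T x)) \<partial>Q) < \<top>"
      using nn_integral_pos_ln_le[OF that(1) T] nn_integral_abs_ln_ratio
      by (simp add: less_top[symmetric] top_unique) (metis ennreal_add_eq_top ennreal_one_neq_top top.not_eq_extremum top.extremum_uniqueI)
    have [measurable]: "T \<in> borel_measurable Q" by measurable
    note pos = expect_ln_finite(1)[OF this fin c] and int = expect_ln_finite(2)[OF this fin c]
    have c_le: "c \<le> (\<integral>x. ln (t x) \<partial>Q)"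
      using c expect_ln_eq_integral[OF \<open>T \<in> borel_measurable Q\<close> pos int] by (simp add: t_def)
    have int_ratio: "integrable Q (\<lambda>x. t x / f x)" and ratio_le: "(\<integral>x. t x / f x \<partial>Q) \<le> 1"
    proof -
      have "(\<integral>\<^sup>+x. ennreal (t x / f x) \<partial>Q) \<le> (\<integral>\<^sup>+x. T x * ennreal (1 / f x) \<partial>Q)"
      proof (rule nn_integral_mono_AE, use f_pos[folded AE_iff] pos in eventually_elim)
        case (elim x)
        then show "ennreal (t x / f x) \<le> T x * ennreal (1 / f x)"
          by (cases "T x") (auto simp: t_def ennreal_mult[symmetric])
      qed
      also have "\<dots> \<le> 1" using T by (simp add: nn_integral_divide_ratio)
      finally have le: "(\<integral>\<^sup>+x. ennreal (t x / f x) \<partial>Q) \<le> 1" .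
      have nonneg: "AE x in Q. 0 \<le> t x / f x"
        using f_pos[folded AE_iff] by eventually_elim (simp add: t_def)
      show int: "integrable Q (\<lambda>x. t x / f x)"
        by (rule integrableI_nonneg[OF _ nonneg]) (use le in \<open>auto simp: less_top[symmetric] top_unique\<close>)
      show "(\<integral>x. t x / f x \<partial>Q) \<le> 1"
        using le nn_integral_eq_integral[OF int nonneg] by simp
    qed
    have int_ln: "integrable Q (\<lambda>x. ln ((1 - \<alpha>) * r x + \<alpha>))"
    proof (rule Q.integrable_const_bound[where B = "\<bar>ln \<alpha>\<bar> + \<bar>ln (C + \<alpha>)\<bar>"], rule AE_I2)
      fix x
      have "(1 - \<alpha>) * r x \<le> 1 * C" using r[of x] \<alpha> by (intro mult_mono) auto
      then have "ln \<alpha> \<le> ln ((1 - \<alpha>) * r x + \<alpha>)" "ln ((1 - \<alpha>) * r x + \<alpha>) \<le> ln (C + \<alpha>)"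
        using r[of x] \<alpha> by (auto intro!: ln_mono add_nonneg_pos)
      then show "norm (ln ((1 - \<alpha>) * r x + \<alpha>)) \<le> \<bar>ln \<alpha>\<bar> + \<bar>ln (C + \<alpha>)\<bar>" by auto
    qed measurable
    define \<rho> where "\<rho> x = t x / f x" for x
    have "c - \<eta> \<le> (\<integral>x. ln (t x) - \<eta> / 2 - (K / C * (\<rho> x) + tail N x) \<partial>Q)"
    proof -
      have "(\<integral>x. ln (t x) - \<eta> / 2 - (K / C * (\<rho> x) + tail N x) \<partial>Q)
          = (\<integral>x. ln (t x) \<partial>Q) - \<eta> / 2 - (K / C * (\<integral>x. \<rho> x \<partial>Q) + (\<integral>x. tail N x \<partial>Q))"
        using int[folded t_def] int_ratio[folded \<rho>_def] tail_int[of N] by (simp add: Q.prob_space)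
      moreover have "K / C * (\<integral>x. \<rho> x \<partial>Q) \<le> \<eta> / 4"
        unfolding C(2) using mult_left_mono[OF ratio_le[folded \<rho>_def], of "\<eta> / 4"] \<eta> by simp
      ultimately show ?thesis using N c_le by linarith
    qed
    also have "\<dots> \<le> (\<integral>x. ln ((1 - \<alpha>) * r x + \<alpha>) \<partial>Q)"
    proof (rule integral_mono_AE)
      show "AE x in Q. ln (t x) - \<eta> / 2 - (K / C * (\<rho> x) + tail N x) \<le> ln ((1 - \<alpha>) * r x + \<alpha>)"
        using pos f_pos[folded AE_iff]
      proof eventually_elim
        case (elim x)
        then have t: "0 < t x" "T x = ennreal (t x)"
          unfolding t_def by (auto simp: enn2real_positive_iff)
        have r_eq: "r x = min (t x) C"
          unfolding r_def t(2) using t(1) C by (simp add: min_def ennreal_le_iff2)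
        have "ln (t x) - max 0 (ln (t x / C)) = ln (r x)"
          unfolding r_eq using t(1) C by (auto simp: min_def max_def ln_divide_pos)
        moreover have "max 0 (ln (t x / C)) \<le> K / C * (\<rho> x) + tail N x"
          unfolding K_def tail_def \<rho>_def using t(1) C elim by (intro pos_ln_le) auto
        moreover have "ln (r x) - \<eta> / 2 = ln ((1 - \<alpha>) * r x)"
          using t(1) C \<alpha> by (subst ln_mult_pos) (auto simp: r_eq)
        moreover have "ln ((1 - \<alpha>) * r x) \<le> ln ((1 - \<alpha>) * r x + \<alpha>)"
          using t(1) C \<alpha> by (intro ln_mono) (auto simp: r_eq intro!: mult_pos_pos)
        ultimately show ?case by linarith
      qed
    qed (use int[folded t_def] int_ratio[folded \<rho>_def] tail_int[of N] int_ln in auto)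
    finally show "c - \<eta> \<le> (\<integral>x. ln ((1 - \<alpha>) * enn2real (min (T x) (ennreal C)) + \<alpha>) \<partial>Q)"
      unfolding r_def .
  qed
  then show ?thesis using \<alpha> C by blast
qed

end

section \<open>Optimality of the likelihood ratio of the maximal invariant\<close>

lemma continuous_action_measurable:
  fixes a :: "'g::topological_space \<Rightarrow> 'y::topological_space \<Rightarrow> 'y"
  assumes cont: "continuous_action a"
  shows "a g \<in> borel_measurable borel"
proof (rule borel_measurable_continuous_onI)
  have "continuous_on UNIV ((\<lambda>(g, x). a g x) \<circ> Pair g)"
    using cont unfolding continuous_action_def
    by (intro continuous_on_compose continuous_intros) (auto elim: continuous_on_subset)
  then show "continuous_on UNIV (a g)" by (simp add: comp_def)
qed

lemma invariant_model_distr: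
  fixes a :: "'g::group_add \<Rightarrow> 'y::topological_space \<Rightarrow> 'y"
  assumes act: "is_action a" and a: "\<And>g. a g \<in> borel_measurable borel"
    and inv: "invariant_model a (+) M" and M: "\<And>g. prob_space (M g)" "\<And>g. sets (M g) = sets borel"
  shows "M (g + h) = distr (M h) borel (a g)"
proof (rule measure_eqI)
  interpret H: prob_space "M h" by fact
  interpret GH: prob_space "M (g + h)" by fact
  fix B assume "B \<in> sets (M (g + h))"
  then have B: "B \<in> sets borel" by (simp add: M)
  have cancel: "a g (a (- g) x) = x" for x
    using act unfolding is_action_def by (metis add.right_inverse)
  have sp: "space (M h) = UNIV" using sets_eq_imp_space_eq[OF M(2)] by simp
  have pre: "a g -` B \<in> sets borel" using measurable_sets[OF a B, of g] by simp
  have "a g ` (a g -` B) = B"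
    by (rule image_vimage_eq[THEN trans]) (metis cancel Int_absorb2 rangeI subsetI)
  then have "measure (M (g + h)) B = measure (M h) (a g -` B)"
    using inv pre unfolding invariant_model_def by metis
  then show "emeasure (M (g + h)) B = emeasure (distr (M h) borel (a g)) B"
    using B a M by (simp add: emeasure_distr sp GH.emeasure_eq_measure H.emeasure_eq_measure
        cong: measurable_cong_sets)
qed (simp add: M)

text \<open>If all translates of an e-statistic grow at least at rate \<open>c\<close>, then truncation and averaging
  produce an invariant function \<open>v\<close> with \<open>\<integral>v \<partial>P \<le> 1\<close> that grows at a rate of almost \<open>c\<close>. On
  invariant functions \<open>Q\<close> has density \<open>\<rho> (m x)\<close> with respect to \<open>P\<close>, so
  \<open>\<integral>v / \<rho> (m x) \<partial>Q \<le> 1\<close>, and Gibbs' inequality bounds the growth of \<open>v\<close> by that of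
  \<open>\<rho> (m x)\<close>.\<close>

lemma growth_le_maximal_invariant:
  fixes a :: "'g::{topological_group_add, second_countable_topology} \<Rightarrow> 'y::polish_space \<Rightarrow> 'y"
    and P Q :: "'y measure" and m :: "'y \<Rightarrow> 'm::polish_space" and \<rho> :: "'m \<Rightarrow> real"
  assumes amenable: "amenable TYPE('g)" and act: "is_action a" and cont: "continuous_action a"
    and PQ: "finite_log_ratio P Q f" and P: "sets P = sets borel"
    and m [measurable]: "m \<in> borel_measurable borel" and max_inv: "maximally_invariant a m"
    and \<rho> [measurable]: "\<rho> \<in> borel_measurable borel" and \<rho>_nonneg: "\<And>z. 0 \<le> \<rho> z"
    and law: "distr Q borel m = density (distr P borel m) (\<lambda>z. ennreal (\<rho> z))"
    and ln_\<rho>: "integrable Q (\<lambda>x. ln (\<rho> (m x)))"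
    and T [measurable]: "T \<in> borel_measurable borel"
    and e: "\<And>g. (\<integral>\<^sup>+x. T (a g x) \<partial>P) \<le> 1" and c: "\<And>g. ereal c \<le> expect_ln Q (\<lambda>x. T (a g x))"
  shows "c \<le> (\<integral>x. ln (\<rho> (m x)) \<partial>Q)"
proof (rule field_le_epsilon)
  fix \<eta> :: real assume "0 < \<eta>"
  interpret finite_log_ratio P Q f by fact
  have Q: "sets Q = sets borel" using sets_Q P by simp
  note P[measurable_cong] Q[measurable_cong]
  have [measurable]: "a g \<in> borel_measurable borel" for g
    using cont by (rule continuous_action_measurable)
  obtain \<alpha> C where \<alpha>: "0 < \<alpha>" "\<alpha> < 1" and C: "0 < C"
    and trunc: "\<And>T. T \<in> borel_measurable P \<Longrightarrow> (\<integral>\<^sup>+x. T x \<partial>P) \<le> 1 \<Longrightarrow> ereal c \<le> expect_ln Q T \<Longrightarrow>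
      (\<integral>x. (1 - \<alpha>) * enn2real (min (T x) (ennreal C)) + \<alpha> \<partial>P) \<le> 1 \<and>
      c - \<eta> \<le> (\<integral>x. ln ((1 - \<alpha>) * enn2real (min (T x) (ennreal C)) + \<alpha>) \<partial>Q)"
    using uniform_truncation[OF \<open>0 < \<eta>\<close>] by metis
  define s where "s x = (1 - \<alpha>) * enn2real (min (T x) (ennreal C)) + \<alpha>" for x
  have s_le: "\<alpha> \<le> s x" "s x \<le> C + \<alpha>" for x
  proof -
    have "enn2real (min (T x) (ennreal C)) \<le> enn2real (ennreal C)"
      by (intro enn2real_mono) auto
    then have "(1 - \<alpha>) * enn2real (min (T x) (ennreal C)) \<le> 1 * C"
      using \<alpha> C by (intro mult_mono) auto
    then show "\<alpha> \<le> s x" "s x \<le> C + \<alpha>" using \<alpha> by (auto simp: s_def)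
  qed
  have s_meas: "s \<in> borel_measurable borel" unfolding s_def by measurable
  have Ta: "(\<lambda>x. T (a g x)) \<in> borel_measurable P" for g by measurable
  have "\<exists>v \<in> borel_measurable borel. (\<forall>x. \<alpha> \<le> v x \<and> v x \<le> C + \<alpha>) \<and> (\<forall>h x. v (a h x) = v x) \<and>
    (\<integral>x. v x \<partial>P) \<le> 1 \<and> c - \<eta> \<le> (\<integral>x. ln (v x) \<partial>Q)"
  proof (rule averaged_orbit_limit[OF amenable act cont P.prob_space_axioms P Q.prob_space_axioms Q _
      s_meas \<alpha>(1) s_le])
    show "(\<integral>x. s (a g x) \<partial>P) \<le> 1" "c - \<eta> \<le> (\<integral>x. ln (s (a g x)) \<partial>Q)" for g
      using trunc[OF Ta e c, of g] unfolding s_def by auto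
  qed (simp add: AE_iff)
  then obtain v where v [measurable]: "v \<in> borel_measurable borel" and v_le: "\<And>x. \<alpha> \<le> v x" "\<And>x. v x \<le> C + \<alpha>"
    and v_inv: "\<And>h x. v (a h x) = v x" and v_P: "(\<integral>x. v x \<partial>P) \<le> 1" and v_Q: "c - \<eta> \<le> (\<integral>x. ln (v x) \<partial>Q)"
    by blast
  have v_sat: "v x = v y" if "m x = m y" for x y
    using that max_inv v_inv unfolding maximally_invariant_def by metis
  have v_pos: "0 < v x" for x using v_le(1)[of x] \<alpha> by linarith
  have "AE z in distr Q borel m. 0 < \<rho> z"
    unfolding law by (subst AE_density) auto
  then have \<rho>_pos: "AE x in Q. 0 < \<rho> (m x)" by (rule AE_distrD[rotated]) measurable
  define N where "N = density P (\<lambda>x. ennreal (\<rho> (m x)))"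
  have law_N: "distr Q borel m = distr N borel m"
    unfolding law N_def by (rule density_distr) auto
  have "finite_measure N"
  proof
    have "emeasure N (space N) = emeasure (distr N borel m) UNIV"
      using sets_eq_imp_space_eq[OF P] by (subst emeasure_distr) (auto simp: N_def)
    also have "\<dots> = 1"
      unfolding law_N[symmetric] using Q.emeasure_space_1 sets_eq_imp_space_eq[OF Q]
      by (subst emeasure_distr) auto
    finally show "emeasure N (space N) \<noteq> \<infinity>" by simp
  qed
  have "(\<integral>\<^sup>+x. ennreal (v x / \<rho> (m x)) \<partial>Q) = (\<integral>\<^sup>+x. ennreal (v x / \<rho> (m x)) \<partial>N)"
  proof (rule nn_integral_saturated_eq[OF m Q Q.finite_measure_axioms _ \<open>finite_measure N\<close> law_N])
    show "ennreal (v x / \<rho> (m x)) = ennreal (v y / \<rho> (m y))" if "m x = m y" for x y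
      by (simp only: that v_sat[OF that])
  qed (simp_all add: N_def P)
  also have "\<dots> = (\<integral>\<^sup>+x. ennreal (\<rho> (m x)) * ennreal (v x / \<rho> (m x)) \<partial>P)"
    unfolding N_def by (rule nn_integral_density) auto
  also have "\<dots> \<le> (\<integral>\<^sup>+x. ennreal (v x) \<partial>P)"
  proof (rule nn_integral_mono)
    show "ennreal (\<rho> (m x)) * ennreal (v x / \<rho> (m x)) \<le> ennreal (v x)" for x
      using v_pos[of x] \<rho>_nonneg[of "m x"]
      by (cases "\<rho> (m x) = 0") (auto simp: ennreal_mult[symmetric] less_imp_le)
  qed
  also have "\<dots> = ennreal (\<integral>x. v x \<partial>P)"
  proof (rule nn_integral_eq_integral)
    show "integrable P v"
      by (rule P.integrable_const_bound[where B = "C + \<alpha>"])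
        (use v_le v_pos in \<open>auto simp: abs_of_pos\<close>)
  qed (use v_pos in \<open>auto simp: less_imp_le\<close>)
  also have "\<dots> \<le> 1" using v_P by simp
  finally have le1: "(\<integral>\<^sup>+x. ennreal (v x / \<rho> (m x)) \<partial>Q) \<le> 1" .
  have nonneg: "AE x in Q. 0 \<le> v x / \<rho> (m x)"
    using v_pos \<rho>_nonneg by (auto simp: less_imp_le)
  have int: "integrable Q (\<lambda>x. v x / \<rho> (m x))"
    by (rule integrableI_nonneg[OF _ nonneg]) (use le1 in \<open>auto simp: less_top[symmetric] top_unique\<close>)
  have int_le: "(\<integral>x. v x / \<rho> (m x) \<partial>Q) \<le> 1"
    using le1 nn_integral_eq_integral[OF int nonneg] by simp
  have ln_v: "integrable Q (\<lambda>x. ln (v x))"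
    by (rule Q.integral_ln_le(1)[OF _ \<alpha>(1) v_le]) measurable
  have "(\<integral>x. ln (v x) \<partial>Q) \<le> (\<integral>x. ln (\<rho> (m x)) + (v x / \<rho> (m x) - 1) \<partial>Q)"
  proof (rule integral_mono_AE)
    show "AE x in Q. ln (v x) \<le> ln (\<rho> (m x)) + (v x / \<rho> (m x) - 1)"
      using \<rho>_pos
    proof eventually_elim
      case (elim x)
      have "ln (v x / \<rho> (m x)) \<le> v x / \<rho> (m x) - 1"
        using v_pos[of x] elim by (intro ln_le_minus_one) auto
      then show ?case using v_pos[of x] elim by (simp add: ln_divide_pos)
    qed
  qed (use ln_v ln_\<rho> int in auto)
  also have "\<dots> \<le> (\<integral>x. ln (\<rho> (m x)) \<partial>Q)"
    using ln_\<rho> int int_le by (simp add: Q.prob_space)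
  finally show "c \<le> (\<integral>x. ln (\<rho> (m x)) \<partial>Q) + \<eta>" using v_Q by linarith
qed

text \<open>When the best attainable growth is the same finite number for every \<open>g\<close>, relative growth is
  growth shifted by a constant, and the two optimality criteria coincide.\<close>

lemma GROW_relatively_GROW_I:
  assumes T: "e_statistic P T" and K: "\<And>g. expect_ln (Q g) T = ereal K"
    and bound: "\<And>S. e_statistic P S \<Longrightarrow> (INF g. expect_ln (Q g) S) \<le> ereal K"
    and L: "\<And>g. (SUP S\<in>{S. e_statistic P S}. expect_ln (Q g) S) = ereal L"
  shows "GROW P Q T \<and> relatively_GROW P Q T"
proof -
  have "relative_growth P Q S \<le> relative_growth P Q T" if S: "e_statistic P S" for S
  proof -
    have "relative_growth P Q S + ereal L \<le> (INF g. expect_ln (Q g) S)"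
    proof (rule INF_greatest)
      fix g
      have "relative_growth P Q S \<le> expect_ln (Q g) S - ereal L"
        unfolding relative_growth_def L by (rule INF_lower) simp
      then show "relative_growth P Q S + ereal L \<le> expect_ln (Q g) S"
        by (simp add: ereal_le_minus)
    qed
    also note bound[OF S]
    finally have "relative_growth P Q S \<le> ereal K - ereal L" by (subst ereal_le_minus) auto
    also have "\<dots> = relative_growth P Q T"
      unfolding relative_growth_def L K by simp
    finally show ?thesis .
  qed
  then show ?thesis
    unfolding GROW_def relatively_GROW_def using T bound K by simp
qed

text \<open>Translating an e-statistic by the action gives an e-statistic again, and moves its growth from
  \<open>Q (h + g)\<close> to \<open>Q g\<close>. Hence the supremal growth does not depend on \<open>g\<close>. It is finite: the
  growth of \<open>T\<close> is a lower bound, and the integrability of \<open>ln f\<close> under \<open>Q 0\<close> gives an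
  upper bound.\<close>

theorem maximal_invariant_GROW:
  fixes a :: "'g::{topological_group_add, second_countable_topology} \<Rightarrow> 'y::polish_space \<Rightarrow> 'y"
    and P Q :: "'g \<Rightarrow> 'y measure" and m :: "'y \<Rightarrow> 'm::polish_space" and \<rho> :: "'m \<Rightarrow> real"
  assumes amenable: "amenable TYPE('g)" and act: "is_action a" and cont: "continuous_action a"
    and P: "\<And>g. prob_space (P g)" "\<And>g. sets (P g) = sets borel" "invariant_model a (+) P"
    and Q: "\<And>g. prob_space (Q g)" "\<And>g. sets (Q g) = sets borel" "invariant_model a (+) Q"
    and PQ: "finite_log_ratio (P 0) (Q 0) f"
    and m: "m \<in> borel_measurable borel" "maximally_invariant a m"
    and \<rho>: "\<rho> \<in> borel_measurable borel" "\<And>z. 0 \<le> \<rho> z"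
    and law: "distr (Q 0) borel m = density (distr (P 0) borel m) (\<lambda>z. ennreal (\<rho> z))"
    and ln_\<rho>: "integrable (Q 0) (\<lambda>x. ln (\<rho> (m x)))"
    and T: "e_statistic P T" and growth_T: "\<And>g. expect_ln (Q g) T = ereal (\<integral>x. ln (\<rho> (m x)) \<partial>Q 0)"
  shows "GROW P Q T \<and> relatively_GROW P Q T"
proof -
  interpret PQ: finite_log_ratio "P 0" "Q 0" f by fact
  define K where "K = (\<integral>x. ln (\<rho> (m x)) \<partial>Q 0)"
  have a [measurable]: "a g \<in> borel_measurable borel" for g
    using cont by (rule continuous_action_measurable)
  have P_shift: "P (g + h) = distr (P h) borel (a g)" and Q_shift: "Q (g + h) = distr (Q h) borel (a g)" for g h
    by (rule invariant_model_distr[OF act a P(3,1,2)] invariant_model_distr[OF act a Q(3,1,2)])+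
  have a_meas: "a g \<in> P h \<rightarrow>\<^sub>M borel" "a g \<in> Q h \<rightarrow>\<^sub>M borel" for g h
    using a P(2) Q(2) by (simp_all cong: measurable_cong_sets)
  have e_int: "(\<integral>\<^sup>+x. S x \<partial>P g) \<le> 1" if "e_statistic P S" for S g
    using that unfolding e_statistic_def by (meson SUP_upper UNIV_I order_trans)
  have S_shift: "e_statistic P (\<lambda>x. S (a h x))"
    and growth_shift: "expect_ln (Q (h + g)) S = expect_ln (Q g) (\<lambda>x. S (a h x))"
    and int_shift: "(\<integral>\<^sup>+x. S x \<partial>P (h + g)) = (\<integral>\<^sup>+x. S (a h x) \<partial>P g)"
    if S: "e_statistic P S" for S h g
  proof -
    have [measurable]: "S \<in> borel_measurable borel" using S by (simp add: e_statistic_def)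
    show int: "(\<integral>\<^sup>+x. S x \<partial>P (h + g)) = (\<integral>\<^sup>+x. S (a h x) \<partial>P g)" for g
      unfolding P_shift by (rule nn_integral_distr[OF a_meas(1)]) simp
    show "e_statistic P (\<lambda>x. S (a h x))"
      unfolding e_statistic_def int[symmetric] by (auto intro!: SUP_least e_int[OF S])
    show "expect_ln (Q (h + g)) S = expect_ln (Q g) (\<lambda>x. S (a h x))"
      unfolding Q_shift by (rule expect_ln_distr[OF a_meas(2)]) simp
  qed
  have bound: "(INF g. expect_ln (Q g) S) \<le> ereal K" if S: "e_statistic P S" for S
  proof (rule ccontr)
    assume "\<not> (INF g. expect_ln (Q g) S) \<le> ereal K"
    then have "ereal K < (INF g. expect_ln (Q g) S)" by simp
    from ereal_dense2[OF this] obtain c where c: "K < c" "ereal c < (INF g. expect_ln (Q g) S)"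
      by auto
    have "ereal c \<le> expect_ln (Q 0) (\<lambda>x. S (a g x))" for g
    proof -
      have "(INF g. expect_ln (Q g) S) \<le> expect_ln (Q g) S" by (rule INF_lower) simp
      with c(2) have "ereal c \<le> expect_ln (Q g) S" by simp
      then show ?thesis using growth_shift[OF S, of g 0] by simp
    qed
    moreover have "(\<integral>\<^sup>+x. S (a g x) \<partial>P 0) \<le> 1" for g
      using e_int[OF S, of g] int_shift[OF S, of g 0] by simp
    moreover have "S \<in> borel_measurable borel" using S by (simp add: e_statistic_def)
    ultimately have "c \<le> K"
      unfolding K_def
      by (intro growth_le_maximal_invariant[OF amenable act cont PQ P(2) m \<rho> law ln_\<rho>])
    with c show False by simp
  qed
  define best where "best g = (SUP S\<in>{S. e_statistic P S}. expect_ln (Q g) S)" for g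
  have best_le: "best (h + g) \<le> best g" for h g
    unfolding best_def
    by (rule SUP_least) (auto simp: growth_shift intro!: SUP_upper S_shift)
  have best_const: "best g = best 0" for g
    using best_le[of g 0] best_le[of "- g" g] by simp
  have "ereal K \<le> best 0"
    unfolding best_def K_def growth_T[of 0, symmetric] by (rule SUP_upper) (simp add: T)
  moreover have "best 0 \<le> enn2ereal (1 + (\<integral>\<^sup>+x. ennreal \<bar>ln (f x)\<bar> \<partial>Q 0))"
    unfolding best_def
  proof (rule SUP_least)
    fix S assume S: "S \<in> {S. e_statistic P S}"
    then have "S \<in> borel_measurable (P 0)"
      using P(2)[of 0] by (simp add: e_statistic_def cong: measurable_cong_sets)
    then show "expect_ln (Q 0) S \<le> enn2ereal (1 + (\<integral>\<^sup>+x. ennreal \<bar>ln (f x)\<bar> \<partial>Q 0))"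
      using S by (intro PQ.expect_ln_le) (auto intro: e_int)
  qed
  moreover have "enn2ereal (1 + (\<integral>\<^sup>+x. ennreal \<bar>ln (f x)\<bar> \<partial>Q 0)) \<noteq> \<infinity>"
    using PQ.nn_integral_abs_ln_ratio
    by (cases "\<integral>\<^sup>+x. ennreal \<bar>ln (f x)\<bar> \<partial>Q 0") (auto simp: plus_ennreal.rep_eq one_ennreal.rep_eq enn2ereal_ennreal)
  ultimately obtain L where "best 0 = ereal L" by (cases "best 0") auto
  then have L: "best g = ereal L" for g using best_const[of g] by simp
  show ?thesis
    by (rule GROW_relatively_GROW_I[OF T growth_T bound[unfolded K_def] L[unfolded best_def]])
qed

section \<open>Mixtures over the parameter of interest\<close>

lemma distr_mixture_density:
  assumes prior: "prob_space prior" and \<kappa>: "\<kappa> \<in> prior \<rightarrow>\<^sub>M prob_algebra N"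
    and \<nu>: "sigma_finite_measure \<nu>" and m: "m \<in> N \<rightarrow>\<^sub>M \<nu>"
    and f: "(\<lambda>(d, z). f d z) \<in> borel_measurable (prior \<Otimes>\<^sub>M \<nu>)"
    and law: "\<And>d. d \<in> space prior \<Longrightarrow> distr (\<kappa> d) \<nu> m = density \<nu> (f d)"
  shows "distr (prior \<bind> \<kappa>) \<nu> m = density \<nu> (\<lambda>z. \<integral>\<^sup>+d. f d z \<partial>prior)"
proof (rule measure_eqI)
  interpret prob_space prior by fact
  interpret \<nu>: sigma_finite_measure \<nu> by fact
  interpret pair_sigma_finite prior \<nu> ..
  note [measurable] = f m
  fix B assume "B \<in> sets (distr (prior \<bind> \<kappa>) \<nu> m)"
  then have B [measurable]: "B \<in> sets \<nu>" by simp
  have \<kappa>': "\<kappa> \<in> prior \<rightarrow>\<^sub>M subprob_algebra N" using \<kappa> by (rule measurable_prob_algebraD)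
  have sets_\<kappa>: "sets (\<kappa> d) = sets N" if "d \<in> space prior" for d
    using sets_kernel[OF \<kappa>' that] .
  have sets_bind: "sets (prior \<bind> \<kappa>) = sets N"
    using sets_\<kappa> not_empty by (rule sets_bind)
  have m': "m \<in> (prior \<bind> \<kappa>) \<rightarrow>\<^sub>M \<nu>" using m sets_bind by (simp cong: measurable_cong_sets)
  have "emeasure (distr (prior \<bind> \<kappa>) \<nu> m) B = emeasure (prior \<bind> \<kappa>) (m -` B \<inter> space N)"
    using m' B sets_eq_imp_space_eq[OF sets_bind] by (simp add: emeasure_distr)
  also have "\<dots> = (\<integral>\<^sup>+d. emeasure (\<kappa> d) (m -` B \<inter> space N) \<partial>prior)"
    by (rule emeasure_bind[OF not_empty \<kappa>']) measurable
  also have "\<dots> = (\<integral>\<^sup>+d. \<integral>\<^sup>+z. f d z * indicator B z \<partial>\<nu> \<partial>prior)"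
  proof (rule nn_integral_cong)
    fix d assume d: "d \<in> space prior"
    have "m \<in> \<kappa> d \<rightarrow>\<^sub>M \<nu>" using m sets_\<kappa>[OF d] by (simp cong: measurable_cong_sets)
    then have "emeasure (\<kappa> d) (m -` B \<inter> space N) = emeasure (distr (\<kappa> d) \<nu> m) B"
      using B sets_eq_imp_space_eq[OF sets_\<kappa>[OF d]] by (simp add: emeasure_distr)
    also have "\<dots> = (\<integral>\<^sup>+z. f d z * indicator B z \<partial>\<nu>)"
      unfolding law[OF d] using B d f by (intro emeasure_density) measurable
    finally show "emeasure (\<kappa> d) (m -` B \<inter> space N) = (\<integral>\<^sup>+z. f d z * indicator B z \<partial>\<nu>)" .
  qed
  also have "\<dots> = (\<integral>\<^sup>+z. \<integral>\<^sup>+d. f d z * indicator B z \<partial>prior \<partial>\<nu>)"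
    by (rule Fubini'[symmetric]) measurable
  also have "\<dots> = (\<integral>\<^sup>+z. (\<integral>\<^sup>+d. f d z \<partial>prior) * indicator B z \<partial>\<nu>)"
    by (intro nn_integral_cong nn_integral_multc) measurable
  also have "\<dots> = emeasure (density \<nu> (\<lambda>z. \<integral>\<^sup>+d. f d z \<partial>prior)) B"
    by (intro emeasure_density[symmetric]) measurable
  finally show "emeasure (distr (prior \<bind> \<kappa>) \<nu> m) B = emeasure (density \<nu> (\<lambda>z. \<integral>\<^sup>+d. f d z \<partial>prior)) B" .
qed simp

lemma (in prob_space) integrable_of_moment:
  fixes f :: "'a \<Rightarrow> real"
  assumes [measurable]: "f \<in> borel_measurable M" and "0 < \<epsilon>"
    and fin: "(\<integral>\<^sup>+x. ennreal (\<bar>f x\<bar> powr (1 + \<epsilon>)) \<partial>M) < \<infinity>"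
  shows "integrable M f"
proof (rule Bochner_Integration.integrable_bound)
  show "integrable M (\<lambda>x. 1 + \<bar>f x\<bar> powr (1 + \<epsilon>))"
    by (intro Bochner_Integration.integrable_add integrableI_nonneg)
      (use fin in \<open>auto simp: emeasure_space_1\<close>)
  have "\<bar>t\<bar> \<le> 1 + \<bar>t\<bar> powr (1 + \<epsilon>)" for t :: real
  proof (cases "\<bar>t\<bar> \<le> 1")
    case False
    then have "\<bar>t\<bar> powr 1 \<le> \<bar>t\<bar> powr (1 + \<epsilon>)" using \<open>0 < \<epsilon>\<close> by (intro powr_mono) auto
    with False show ?thesis by simp
  qed (use powr_ge_zero[of "\<bar>t\<bar>" "1 + \<epsilon>"] in linarith)
  then show "AE x in M. norm (f x) \<le> norm (1 + \<bar>f x\<bar> powr (1 + \<epsilon>))" by simp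
qed simp

theorem corollary9:
  fixes act :: "'g::{topological_group_add, polish_space} \<Rightarrow> 'x::polish_space \<Rightarrow> 'x"
    and pact :: "'g \<Rightarrow> 't \<Rightarrow> 't"
    and P :: "'t \<Rightarrow> ('n::finite \<Rightarrow> 'x) measure"
    and \<delta> :: "'t \<Rightarrow> 'd"
    and rep :: "'d \<Rightarrow> 't"
    and \<Delta>\<^sub>0 \<Delta>\<^sub>1 :: "'d set"
    and prior\<^sub>0 prior\<^sub>1 :: "'d measure"
    and Pt Qt :: "'g \<Rightarrow> ('n \<Rightarrow> 'x) measure"
    and m :: "('n \<Rightarrow> 'x) \<Rightarrow> 'm::polish_space"
    and \<nu> :: "'m measure"
    and pM qM :: "'d \<Rightarrow> 'm \<Rightarrow> real"
    and ptM qtM :: "'m \<Rightarrow> real"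
    and \<mu> :: "('n \<Rightarrow> 'x) measure"
    and \<kappa> :: "'g \<Rightarrow> real"
    and pt qt :: "'g \<Rightarrow> ('n \<Rightarrow> 'x) \<Rightarrow> real"
    and \<epsilon> :: real
    and T :: "('n \<Rightarrow> 'x) \<Rightarrow> ennreal"
  \<comment> \<open>the invariant model\<close>
  assumes "is_action act"
    and "is_action pact" and "free_action pact"
    and "\<And>\<theta>. prob_space (P \<theta>)" and "\<And>\<theta>. sets (P \<theta>) = sets borel"
    and "invariant_model (componentwise act) pact P"
    and "maximally_invariant pact \<delta>"
    and "\<And>d. d \<in> range \<delta> \<Longrightarrow> \<delta> (rep d) = d"
    and "\<Delta>\<^sub>0 \<subseteq> range \<delta>" and "\<Delta>\<^sub>1 \<subseteq> range \<delta>"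
  \<comment> \<open>the priors and the mixtures\<close>
    and "prob_space prior\<^sub>0" and "space prior\<^sub>0 = \<Delta>\<^sub>0"
    and "prob_space prior\<^sub>1" and "space prior\<^sub>1 = \<Delta>\<^sub>1"
    and "(\<lambda>(g, d). P (pact g (rep d))) \<in> borel \<Otimes>\<^sub>M prior\<^sub>0 \<rightarrow>\<^sub>M prob_algebra borel"
    and "(\<lambda>(g, d). P (pact g (rep d))) \<in> borel \<Otimes>\<^sub>M prior\<^sub>1 \<rightarrow>\<^sub>M prob_algebra borel"
    and "\<And>g. Pt g = prior\<^sub>0 \<bind> (\<lambda>d. P (pact g (rep d)))"
    and "\<And>g. Qt g = prior\<^sub>1 \<bind> (\<lambda>d. P (pact g (rep d)))"
  \<comment> \<open>the maximally invariant statistic and its densities\<close>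
    and "m \<in> borel_measurable borel"
    and "maximally_invariant (componentwise act) m"
    and "sets \<nu> = sets borel" and "sigma_finite_measure \<nu>"
    and "\<And>d z. d \<in> \<Delta>\<^sub>0 \<Longrightarrow> 0 \<le> pM d z"
    and "\<And>d z. d \<in> \<Delta>\<^sub>1 \<Longrightarrow> 0 \<le> qM d z"
    and "(\<lambda>(d, z). pM d z) \<in> borel_measurable (prior\<^sub>0 \<Otimes>\<^sub>M borel)"
    and "(\<lambda>(d, z). qM d z) \<in> borel_measurable (prior\<^sub>1 \<Otimes>\<^sub>M borel)"
    and "\<And>g d. d \<in> \<Delta>\<^sub>0 \<Longrightarrow> distributed (P (pact g (rep d))) \<nu> m (\<lambda>z. ennreal (pM d z))"
    and "\<And>g d. d \<in> \<Delta>\<^sub>1 \<Longrightarrow> distributed (P (pact g (rep d))) \<nu> m (\<lambda>z. ennreal (qM d z))"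
    and "\<And>z. 0 \<le> ptM z" and "\<And>z. 0 \<le> qtM z"
    and "\<And>g. distributed (Pt g) \<nu> m (\<lambda>z. ennreal (ptM z))"
    and "\<And>g. distributed (Qt g) \<nu> m (\<lambda>z. ennreal (qtM z))"
  \<comment> \<open>amenability and conditions (1)--(4)\<close>
    and "amenable TYPE('g)"
    and "locally_compact_space (euclidean :: 'g topology)"
    and "locally_compact_space (euclidean :: ('n \<Rightarrow> 'x) topology)"
    and "free_action (componentwise act :: 'g \<Rightarrow> ('n \<Rightarrow> 'x) \<Rightarrow> ('n \<Rightarrow> 'x))"
    and "continuous_action (componentwise act :: 'g \<Rightarrow> ('n \<Rightarrow> 'x) \<Rightarrow> ('n \<Rightarrow> 'x))"
    and "proper_action (componentwise act :: 'g \<Rightarrow> ('n \<Rightarrow> 'x) \<Rightarrow> ('n \<Rightarrow> 'x))"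
    and "invariant_model (componentwise act) (+) Pt"
    and "invariant_model (componentwise act) (+) Qt"
    and "sets \<mu> = sets borel" and "relatively_left_invariant (componentwise act) \<mu> \<kappa>"
    and "\<And>g x. 0 \<le> pt g x" and "\<And>g x. 0 \<le> qt g x"
    and "\<And>g. distributed (Pt g) \<mu> (\<lambda>x. x) (\<lambda>x. ennreal (pt g x))"
    and "\<And>g. distributed (Qt g) \<mu> (\<lambda>x. x) (\<lambda>x. ennreal (qt g x))"
    and "\<exists>S. \<forall>g. {x. 0 < pt g x} = S \<and> {x. 0 < qt g x} = S"
    and "0 < \<epsilon>"
    and "(\<integral>\<^sup>+x. ennreal (\<bar>ln (qt 0 x / pt 0 x)\<bar> powr (1 + \<epsilon>)) \<partial>Qt 0) < \<infinity>"
    and "(\<integral>\<^sup>+x. ennreal (\<bar>ln (qtM (m x) / ptM (m x))\<bar> powr (1 + \<epsilon>)) \<partial>Qt 0) < \<infinity>"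
  \<comment> \<open>the e-statistic\<close>
    and "\<And>x. T x = (\<integral>\<^sup>+d. ennreal (qM d (m x)) \<partial>prior\<^sub>1) / (\<integral>\<^sup>+d. ennreal (pM d (m x)) \<partial>prior\<^sub>0)"
  shows "GROW Pt Qt T \<and> relatively_GROW Pt Qt T"
proof -
  let ?a = "componentwise act :: 'g \<Rightarrow> ('n \<Rightarrow> 'x) \<Rightarrow> ('n \<Rightarrow> 'x)"
  have act: "is_action ?a"
    using assms(1) by (simp add: is_action_def componentwise_def)
  have kernel\<^sub>0: "(\<lambda>d. P (pact g (rep d))) \<in> prior\<^sub>0 \<rightarrow>\<^sub>M prob_algebra borel"
    and kernel\<^sub>1: "(\<lambda>d. P (pact g (rep d))) \<in> prior\<^sub>1 \<rightarrow>\<^sub>M prob_algebra borel" for g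
    using measurable_compose[OF measurable_Pair1'[of g borel prior\<^sub>0] assms(15)]
      measurable_compose[OF measurable_Pair1'[of g borel prior\<^sub>1] assms(16)] by simp_all
  have prior: "prior\<^sub>0 \<in> space (prob_algebra prior\<^sub>0)" "prior\<^sub>1 \<in> space (prob_algebra prior\<^sub>1)"
    using assms(11,13) by (simp_all add: space_prob_algebra)
  have Pt: "prob_space (Pt g)" "sets (Pt g) = sets borel" for g
    unfolding assms(17) using prob_space_bind'[OF prior(1) kernel\<^sub>0] sets_bind'[OF prior(1) kernel\<^sub>0] .
  have Qt: "prob_space (Qt g)" "sets (Qt g) = sets borel" for g
    unfolding assms(18) using prob_space_bind'[OF prior(2) kernel\<^sub>1] sets_bind'[OF prior(2) kernel\<^sub>1] .
  interpret P0: prob_space "Pt 0" by (rule Pt)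
  interpret Q0: prob_space "Qt 0" by (rule Qt)
  interpret \<nu>: sigma_finite_measure \<nu> by (rule assms(22))
  note sets [measurable_cong] = Pt(2) Qt(2) assms(21,41)
  note m [measurable] = assms(19)

  define f where "f x = qt 0 x / pt 0 x" for x
  have support: "0 < pt 0 x \<longleftrightarrow> 0 < qt 0 x" for x
    using assms(47) by blast
  have pt [measurable]: "pt 0 \<in> borel_measurable borel" and qt [measurable]: "qt 0 \<in> borel_measurable borel"
    using distributed_real_measurable[OF _ assms(45)[of 0]] distributed_real_measurable[OF _ assms(46)[of 0]]
      assms(41,43,44) by (simp_all cong: measurable_cong_sets)
  have Pt_density: "Pt 0 = density \<mu> (\<lambda>x. ennreal (pt 0 x))" and Qt_density: "Qt 0 = density \<mu> (\<lambda>x. ennreal (qt 0 x))"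
    using assms(45,46)[of 0] by (simp_all add: distributed_def distr_id2 sets)
  have f [measurable]: "f \<in> borel_measurable borel" unfolding f_def by measurable
  have f_pos: "AE x in Pt 0. 0 < f x"
    unfolding Pt_density f_def using support by (subst AE_density) auto
  have Q_eq: "Qt 0 = density (Pt 0) (\<lambda>x. ennreal (f x))"
  proof -
    have "ennreal (pt 0 x) * ennreal (f x) = ennreal (qt 0 x)" for x
    proof (cases "0 < pt 0 x")
      case True
      then show ?thesis using assms(44)[of 0 x] by (simp add: f_def ennreal_mult[symmetric])
    next
      case False
      then have "pt 0 x = 0" "qt 0 x = 0"
        using support[of x] assms(43)[of 0 x] assms(44)[of 0 x] by auto
      then show ?thesis by simp
    qed
    then show ?thesis
      unfolding Pt_density Qt_density by (subst density_density_eq) (auto simp: sets)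
  qed
  have PQ: "finite_log_ratio (Pt 0) (Qt 0) f"
  proof
    show "f \<in> borel_measurable (Pt 0)" by measurable
    show "integrable (Qt 0) (\<lambda>x. ln (f x))"
      using assms(49) unfolding f_def[symmetric] by (intro Q0.integrable_of_moment[OF _ assms(48)]) measurable
  qed (fact Q_eq f_pos)+
  then interpret PQ: finite_log_ratio "Pt 0" "Qt 0" f .

  define \<rho> where "\<rho> z = qtM z / ptM z" for z
  have ptM [measurable]: "ptM \<in> borel_measurable borel" and qtM [measurable]: "qtM \<in> borel_measurable borel"
    using distributed_real_measurable[OF _ assms(31)[of 0]] distributed_real_measurable[OF _ assms(32)[of 0]]
      assms(21,29,30) by (simp_all cong: measurable_cong_sets)
  have \<rho> [measurable]: "\<rho> \<in> borel_measurable borel" unfolding \<rho>_def by measurable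
  have \<rho>_nonneg: "0 \<le> \<rho> z" for z using assms(29,30) by (simp add: \<rho>_def)
  have m_\<nu>: "m \<in> Pt g \<rightarrow>\<^sub>M \<nu>" "m \<in> Qt g \<rightarrow>\<^sub>M \<nu>" for g by measurable
  have law_P: "distr (Pt g) \<nu> m = density \<nu> (\<lambda>z. ennreal (ptM z))"
    and law_Q: "distr (Qt g) \<nu> m = density \<nu> (\<lambda>z. ennreal (qtM z))" for g
    using assms(31,32)[of g] by (simp_all add: distributed_def)
  \<comment> \<open>The supports of the densities of \<open>m\<close> are compared through the common support upstairs.\<close>
  have ptM_pos: "AE z in \<nu>. 0 < qtM z \<longrightarrow> 0 < ptM z"
  proof -
    have "AE z in distr (Pt 0) \<nu> m. 0 < ptM z"
      unfolding law_P by (subst AE_density) auto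
    then have "AE x in Pt 0. 0 < ptM (m x)" by (rule AE_distrD[OF m_\<nu>(1)])
    then have "AE x in Qt 0. 0 < ptM (m x)" by (simp add: PQ.AE_iff)
    then have "AE z in distr (Qt 0) \<nu> m. 0 < ptM z"
      by (subst AE_distr_iff[OF m_\<nu>(2)]) auto
    then show ?thesis
      unfolding law_Q by (subst (asm) AE_density) auto
  qed
  have law: "distr (Qt 0) borel m = density (distr (Pt 0) borel m) (\<lambda>z. ennreal (\<rho> z))"
  proof -
    have "density \<nu> (\<lambda>z. ennreal (qtM z)) = density (density \<nu> (\<lambda>z. ennreal (ptM z))) (\<lambda>z. ennreal (\<rho> z))"
    proof (subst density_density_eq)
      show "density \<nu> (\<lambda>z. ennreal (qtM z)) = density \<nu> (\<lambda>z. ennreal (ptM z) * ennreal (\<rho> z))"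
      proof (rule density_cong)
        show "AE z in \<nu>. ennreal (qtM z) = ennreal (ptM z) * ennreal (\<rho> z)"
          using ptM_pos
        proof eventually_elim
          case (elim z)
          show ?case
          proof (cases "qtM z = 0")
            case False
            with elim assms(30)[of z] have "0 < ptM z" by (simp add: order_less_le)
            then show ?thesis using assms(30)[of z] by (simp add: \<rho>_def ennreal_mult[symmetric])
          qed (simp add: \<rho>_def)
        qed
      qed measurable
    qed measurable
    moreover have "distr (Qt 0) borel m = distr (Qt 0) \<nu> m" "distr (Pt 0) borel m = distr (Pt 0) \<nu> m"
      by (rule distr_cong; simp add: assms(21))+
    ultimately show ?thesis by (simp add: law_P law_Q)
  qed
  have ln_\<rho>: "integrable (Qt 0) (\<lambda>x. ln (\<rho> (m x)))"
    using assms(50) unfolding \<rho>_def[symmetric] by (intro Q0.integrable_of_moment[OF _ assms(48)]) measurable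

  \<comment> \<open>\<open>T\<close> and \<open>\<rho> (m x)\<close> agree only almost everywhere: both arise from densities of \<open>m\<close>, which are
    unique up to \<open>\<nu>\<close>-null sets.\<close>
  define p q where "p z = (\<integral>\<^sup>+d. ennreal (pM d z) \<partial>prior\<^sub>0)" and "q z = (\<integral>\<^sup>+d. ennreal (qM d z) \<partial>prior\<^sub>1)" for z
  have pM_meas: "(\<lambda>(d, z). ennreal (pM d z)) \<in> borel_measurable (prior\<^sub>0 \<Otimes>\<^sub>M \<nu>)"
    and qM_meas: "(\<lambda>(d, z). ennreal (qM d z)) \<in> borel_measurable (prior\<^sub>1 \<Otimes>\<^sub>M \<nu>)"
    using assms(25,26) by measurable
  note [measurable] = pM_meas qM_meas
  interpret prior\<^sub>0: prob_space prior\<^sub>0 by (rule assms(11))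
  interpret prior\<^sub>1: prob_space prior\<^sub>1 by (rule assms(13))
  have p\<nu> [measurable]: "p \<in> borel_measurable \<nu>" and q\<nu> [measurable]: "q \<in> borel_measurable \<nu>"
    unfolding p_def q_def by measurable
  have m_borel_\<nu>: "m \<in> borel \<rightarrow>\<^sub>M \<nu>" by measurable
  have "distr (Pt 0) \<nu> m = density \<nu> p"
    unfolding assms(17) p_def using assms(12,27)
    by (intro distr_mixture_density[OF assms(11) kernel\<^sub>0 assms(22) m_borel_\<nu> pM_meas])
      (auto simp: distributed_def)
  then have p_eq: "AE z in \<nu>. p z = ennreal (ptM z)"
    unfolding law_P by (subst (asm) \<nu>.density_unique_iff) auto
  have "distr (Qt 0) \<nu> m = density \<nu> q"
    unfolding assms(18) q_def using assms(14,28)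
    by (intro distr_mixture_density[OF assms(13) kernel\<^sub>1 assms(22) m_borel_\<nu> qM_meas])
      (auto simp: distributed_def)
  then have q_eq: "AE z in \<nu>. q z = ennreal (qtM z)"
    unfolding law_Q by (subst (asm) \<nu>.density_unique_iff) auto
  define \<tau> where "\<tau> z = q z / p z" for z
  have T: "T = (\<lambda>x. \<tau> (m x))"
    using assms(51) by (simp add: fun_eq_iff \<tau>_def p_def q_def)
  have \<tau> [measurable]: "\<tau> \<in> borel_measurable \<nu>" unfolding \<tau>_def by measurable
  have T_meas [measurable]: "T \<in> borel_measurable borel" unfolding T by measurable

  have "e_statistic Pt T"
    unfolding e_statistic_def
  proof (intro conjI SUP_least)
    fix g
    interpret Qg: prob_space "Qt g" by (rule Qt)
    have "(\<integral>\<^sup>+x. T x \<partial>Pt g) = (\<integral>\<^sup>+z. \<tau> z \<partial>distr (Pt g) \<nu> m)"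
      unfolding T by (rule nn_integral_distr[OF m_\<nu>(1), symmetric]) simp
    also have "\<dots> = (\<integral>\<^sup>+z. ennreal (ptM z) * \<tau> z \<partial>\<nu>)"
      unfolding law_P by (rule nn_integral_density) auto
    also have "\<dots> \<le> (\<integral>\<^sup>+z. ennreal (qtM z) \<partial>\<nu>)"
    proof (rule nn_integral_mono_AE, use p_eq q_eq in eventually_elim)
      case (elim z)
      show ?case
      proof (cases "ptM z = 0")
        case False
        then have "0 < ptM z" using assms(29)[of z] by simp
        then have "ennreal (ptM z) * (ennreal (qtM z) / ennreal (ptM z)) = ennreal (qtM z)"
          using assms(30)[of z] by (simp add: divide_ennreal ennreal_mult[symmetric])
        with elim show ?thesis by (simp add: \<tau>_def)
      qed simp
    qed
    also have "\<dots> = emeasure (distr (Qt g) \<nu> m) (space \<nu>)"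
      unfolding law_Q by (subst emeasure_density) (auto intro!: nn_integral_cong)
    also have "\<dots> = 1"
      using Qg.prob_space_distr[OF m_\<nu>(2)] prob_space.emeasure_space_1 by fastforce
    finally show "(\<integral>\<^sup>+x. T x \<partial>Pt g) \<le> 1" .
  qed (fact T_meas)
  moreover have "expect_ln (Qt g) T = ereal (\<integral>x. ln (\<rho> (m x)) \<partial>Qt 0)" for g
  proof -
    have const: "expect_ln (Qt g) T = expect_ln (Qt 0) T"
      unfolding T expect_ln_distr[OF m_\<nu>(2) \<tau>, symmetric] law_Q ..
    have "AE z in distr (Qt 0) \<nu> m. 0 < \<rho> z \<and> \<tau> z = ennreal (\<rho> z)"
    proof -
      have "AE z in \<nu>. 0 < ennreal (qtM z) \<longrightarrow> 0 < \<rho> z \<and> \<tau> z = ennreal (\<rho> z)"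
        using ptM_pos p_eq q_eq
        by eventually_elim (auto simp: \<tau>_def \<rho>_def divide_ennreal)
      then show ?thesis unfolding law_Q by (subst AE_density) auto
    qed
    then have eq: "AE x in Qt 0. 0 < \<rho> (m x) \<and> T x = ennreal (\<rho> (m x))"
      unfolding T by (rule AE_distrD[OF m_\<nu>(2)])
    have ln_eq: "AE x in Qt 0. ln (enn2real (T x)) = ln (\<rho> (m x))"
      using eq by eventually_elim simp
    have [measurable]: "T \<in> borel_measurable (Qt 0)" by measurable
    have "expect_ln (Qt 0) T = ereal (\<integral>x. ln (enn2real (T x)) \<partial>Qt 0)"
    proof (rule expect_ln_eq_integral)
      show "AE x in Qt 0. 0 < T x \<and> T x < \<top>" using eq by eventually_elim simp
      show "integrable (Qt 0) (\<lambda>x. ln (enn2real (T x)))"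
        using ln_\<rho> ln_eq by (subst integrable_cong_AE[where g = "\<lambda>x. ln (\<rho> (m x))"]) auto
    qed measurable
    also have "(\<integral>x. ln (enn2real (T x)) \<partial>Qt 0) = (\<integral>x. ln (\<rho> (m x)) \<partial>Qt 0)"
      using ln_eq by (intro integral_cong_AE) auto
    finally show ?thesis unfolding const .
  qed
  ultimately show ?thesis
    by (intro maximal_invariant_GROW[OF assms(33) act assms(37) Pt assms(39) Qt assms(40) PQ m assms(20)
          \<rho> \<rho>_nonneg law ln_\<rho>])
qed

end
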